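(* Let $r_0$ be the support function of a $C^2$-smooth surface $S_0\subset\mathbb{E}^3$ bounding a convex body of constant width $w_0$. For each real $C$ for which $r_0+C$ is the support function of a $C^2$-smooth closed convex surface, let $S_C$ denote that surface (it has constant width $w_0+2C$). Then $$\frac{d}{dC}\,\mathcal{I}(S_C)\;\geq\;0 .$$
   Context: For a closed convex body in Euclidean 3-space $\mathbb{E}^3$ with boundary surface $S$, the support function $r:S^2\to\mathbb{R}$ gives the (signed) distance from the origin to the tangent plane of $S$ with a given outward unit normal direction. With $\tau$ the antipodal map on $S^2$, the width of $S$ is the function $r+r\circ\tau$, and $S$ has constant width $w$ if $r+r\circ\tau\equiv w$. For a surface $S$ bounding a convex body of constant width $w$, $$\mathcal{I}(S)=\frac{\mathrm{Vol}(S)}{\mathrm{Vol}(S^2_w)},$$ where $\mathrm{Vol}(S)$ is the volume enclosed by $S$ and $S^2_w$ is the round 2-sphere of width (i.e. diameter) $w$, so $\mathrm{Vol}(S^2_w)=\pi w^3/6$. Geometrically, $S_C$ is obtained from $S_0$ by moving each point a signed distance $C$ along its outward normal line. *)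

theory Defs
  imports "HOL-Analysis.Analysis"
begin

definition bounds_convex_body :: "(real^3) set \<Rightarrow> (real^3) set \<Rightarrow> bool" where
  "bounds_convex_body S K \<longleftrightarrow> compact K \<and> convex K \<and> interior K \<noteq> {} \<and> S = frontier K"

definition closed_convex_surface :: "(real^3) set \<Rightarrow> bool" where
  "closed_convex_surface S \<longleftrightarrow> (\<exists>K. bounds_convex_body S K)"

text \<open>
  A \<open>C\<^sup>2\<close> function on \<open>U\<close>, with its gradient \<open>G\<close> as explicit witness; \<open>H\<close> is the second
  derivative, as the derivative of the gradient.
\<close>

definition C2_with_gradient_on ::
    "(real^3 \<Rightarrow> real) \<Rightarrow> (real^3 \<Rightarrow> real^3) \<Rightarrow> (real^3) set \<Rightarrow> bool" where
  "C2_with_gradient_on f G U \<longleftrightarrow>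
     (\<exists>H :: real^3 \<Rightarrow> (real^3) \<Rightarrow>\<^sub>L (real^3).
        (\<forall>x\<in>U. (f has_derivative (\<lambda>h. G x \<bullet> h)) (at x)) \<and>
        (\<forall>x\<in>U. (G has_derivative blinfun_apply (H x)) (at x)) \<and>
        continuous_on U H)"

text \<open>
  A \<open>C\<^sup>2\<close>-smooth surface is an embedded \<open>C\<^sup>2\<close> hypersurface: near each of its points it is a
  regular level set of a \<open>C\<^sup>2\<close> function.
\<close>

definition C2_smooth_surface :: "(real^3) set \<Rightarrow> bool" where
  "C2_smooth_surface S \<longleftrightarrow>
     (\<forall>p\<in>S. \<exists>U f G. open U \<and> p \<in> U \<and> C2_with_gradient_on f G U \<and>
        S \<inter> U = {x \<in> U. f x = 0} \<and> (\<forall>x\<in>U. G x \<noteq> 0))"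

text \<open>
  Only directions \<open>u\<close> on the unit sphere are of interest. For a surface bounding a convex body
  this is the signed distance from the origin to the supporting plane with outward unit
  normal \<open>u\<close>, which is the tangent plane where the surface is differentiable.
\<close>

definition support_function :: "(real^3) set \<Rightarrow> real^3 \<Rightarrow> real" where
  "support_function S u = (SUP x\<in>S. x \<bullet> u)"

definition has_support_function :: "(real^3) set \<Rightarrow> (real^3 \<Rightarrow> real) \<Rightarrow> bool" where
  "has_support_function S r \<longleftrightarrow> (\<forall>u\<in>sphere 0 1. support_function S u = r u)"

definition width :: "(real^3) set \<Rightarrow> real^3 \<Rightarrow> real" where
  "width S u = support_function S u + support_function S (- u)"

definition has_constant_width :: "(real^3) set \<Rightarrow> real \<Rightarrow> bool" where
  "has_constant_width S w \<longleftrightarrow> (\<forall>u\<in>sphere 0 1. width S u = w)"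

definition constant_width :: "(real^3) set \<Rightarrow> real" where
  "constant_width S = (THE w. has_constant_width S w)"

text \<open>\<open>inside S\<close> is the union of the bounded components of the complement of \<open>S\<close>.\<close>

definition enclosed_volume :: "(real^3) set \<Rightarrow> real" where
  "enclosed_volume S = measure lebesgue (inside S)"

text \<open>Meaningful only for surfaces of constant width.\<close>

definition isoperimetric_ratio :: "(real^3) set \<Rightarrow> real" where
  "isoperimetric_ratio S =
     enclosed_volume S / enclosed_volume (sphere 0 (constant_width S / 2))"

text \<open>
  A convex body is determined by its support function on the unit sphere, so there is at most
  one such surface. The value is unspecified if there is none.
\<close>

definition surface_with_support :: "(real^3 \<Rightarrow> real) \<Rightarrow> (real^3) set" where
  "surface_with_support r = (THE S. closed_convex_surface S \<and> has_support_function S r)"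

lemma inside_of_body:
  assumes "bounds_convex_body S K"
  shows "inside S = interior K"
  using assms inside_frontier_eq_interior[of K]
  by (auto simp: bounds_convex_body_def compact_imp_bounded)

lemma enclosed_volume_eq_body:
  assumes "bounds_convex_body S K"
  shows "enclosed_volume S = measure lebesgue K"
proof -
  have K: "compact K" "convex K" using assms by (auto simp: bounds_convex_body_def)
  have "negligible (frontier K)" using K negligible_convex_frontier by blast
  then have "negligible (sym_diff (interior K) K)"
    using K by (elim negligible_subset)
      (auto simp: frontier_def closure_closed compact_imp_closed dest: interior_subset[THEN subsetD])
  then have "measure lebesgue (interior K) = measure lebesgue K"
    using K measure_negligible_symdiff[of "interior K" K] lmeasurable_interior
      compact_imp_bounded lmeasurable_compact
    by (metis (no_types, lifting) fmeasurableD measure_negligible_symdiff)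
  then show ?thesis
    by (simp add: enclosed_volume_def inside_of_body[OF assms])
qed

lemma enclosed_volume_sphere:
  assumes "w > 0"
  shows "enclosed_volume (sphere 0 (w / 2)) = pi * w ^ 3 / 6"
proof -
  have "bounds_convex_body (sphere 0 (w / 2)) (cball (0::real^3) (w / 2))"
    using assms by (auto simp: bounds_convex_body_def)
  then show ?thesis
    using assms content_cball[of "w / 2" "0::real^3"]
    by (simp add: enclosed_volume_eq_body content_cball unit_ball_vol_3 power_divide)
qed

lemma constant_width_eq:
  assumes "has_constant_width S w"
  shows "constant_width S = w"
proof -
  obtain u :: "real^3" where "u \<in> sphere 0 1"
    using vector_choose_size[of 1, where 'a="real^3"] by auto
  with assms show ?thesis
    unfolding constant_width_def has_constant_width_def by (intro the_equality) auto
qed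

lemma support_halfspaces:
  assumes "bounds_convex_body S K" and "has_support_function S r"
  shows "K = {x. \<forall>u\<in>sphere 0 1. x \<bullet> u \<le> r u}"
proof -
  have K: "compact K" "convex K" "interior K \<noteq> {}" and S: "S = frontier K"
    using assms by (auto simp: bounds_convex_body_def)
  have SK: "S \<subseteq> K" using K S by (simp add: compact_imp_closed frontier_subset_closed)
  have cS: "compact S" using K S compact_frontier by blast
  have "K \<noteq> {}" using K by auto
  moreover have "K \<noteq> UNIV" using K(1) compact_imp_bounded not_bounded_UNIV by metis
  ultimately have "S \<noteq> {}" using S frontier_eq_empty by blast
  have r: "r u = (SUP x\<in>S. x \<bullet> u)" if "u \<in> sphere 0 1" for u
    using assms(2) that by (auto simp: has_support_function_def support_function_def)
  have KS: "K = convex hull S"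
    using K S Krein_Milman_frontier by blast
  show ?thesis
  proof (intro equalityI subsetI CollectI ballI)
    fix x u :: "real^3"
    assume x: "x \<in> K" and u: "u \<in> sphere 0 1"
    have "bdd_above ((\<lambda>y. y \<bullet> u) ` S)"
      using cS by (intro bounded_imp_bdd_above compact_imp_bounded compact_continuous_image)
        (auto intro!: continuous_intros)
    then have "S \<subseteq> {y. u \<bullet> y \<le> r u}"
      using r[OF u] by (auto simp: inner_commute intro: cSUP_upper2)
    then have "K \<subseteq> {y. u \<bullet> y \<le> r u}"
      unfolding KS by (intro hull_minimal) (auto simp: convex_halfspace_le)
    with x show "x \<bullet> u \<le> r u" by (auto simp: inner_commute)
  next
    fix x assume "x \<in> {x. \<forall>u\<in>sphere 0 1. x \<bullet> u \<le> r u}"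
    then have x: "x \<bullet> u \<le> r u" if "u \<in> sphere 0 1" for u using that by auto
    show "x \<in> K"
    proof (rule ccontr)
      assume "x \<notin> K"
      then obtain a b where ab: "a \<bullet> x < b" "\<And>y. y \<in> K \<Longrightarrow> a \<bullet> y > b"
        using separating_hyperplane_closed_point[of K x] K compact_imp_closed by metis
      have "a \<noteq> 0" using ab \<open>K \<noteq> {}\<close> by force
      define u where "u = - (a /\<^sub>R norm a)"
      have u: "u \<in> sphere 0 1" using \<open>a \<noteq> 0\<close> by (simp add: u_def)
      have "r u \<le> - b / norm a"
        unfolding r[OF u]
      proof (rule cSUP_least[OF \<open>S \<noteq> {}\<close>])
        fix y assume "y \<in> S"
        then have "b < a \<bullet> y" using ab SK by auto
        then show "y \<bullet> u \<le> - b / norm a"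
          using \<open>a \<noteq> 0\<close> by (simp add: u_def inner_commute field_simps)
      qed
      also have "\<dots> < x \<bullet> u"
        using \<open>a \<noteq> 0\<close> ab(1) by (simp add: u_def inner_commute field_simps)
      finally show False using x[OF u] by simp
    qed
  qed
qed

lemma surface_with_support_eq:
  assumes "closed_convex_surface S" and "has_support_function S r"
  shows "surface_with_support r = S"
proof -
  have "S' = S" if S': "closed_convex_surface S'" "has_support_function S' r" for S'
  proof -
    obtain K where K: "bounds_convex_body S K"
      using assms(1) unfolding closed_convex_surface_def by blast
    obtain K' where K': "bounds_convex_body S' K'"
      using S'(1) unfolding closed_convex_surface_def by blast
    have "K = K'"
      using support_halfspaces[OF K assms(2)] support_halfspaces[OF K' S'(2)] by (rule trans[OF _ sym])
    with K K' show ?thesis by (simp add: bounds_convex_body_def)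
  qed
  then show ?thesis
    unfolding surface_with_support_def using assms by (intro the_equality) blast+
qed

end

theory Submission
  imports Defs "HOL-Probability.Distribution_Functions"
begin

text \<open>
  All bodies \<open>S\<^sub>c\<close> with \<open>c\<close> near \<open>C\<close> are parallel bodies \<open>K + t B\<close>, \<open>t = \<epsilon> + (c - C)\<close>, of one fixed
  compact convex set \<open>K\<close>, where \<open>B\<close> is the unit ball. Outwards this is immediate;
  inwards it is where \<open>C\<^sup>2\<close>-smoothness enters. A compact \<open>C\<^sup>2\<close> surface has balls of a uniform radius \<open>\<epsilon>\<close> touching it from the inside at every
  point (\<open>rolling_ball\<close>), so the centres of all \<open>\<epsilon>\<close>-balls contained in the body of \<open>S\<^sub>C\<close> form a
  set \<open>K\<close> with support function exactly \<open>r\<^sub>0 + C - \<epsilon>\<close> (\<open>inner_parallel_body\<close>). The interior of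
  \<open>K\<close> may be empty, as for a sphere of radius \<open>\<epsilon>\<close>.

  Let \<open>V(t)\<close> be the volume of \<open>K + t B\<close> and \<open>g = V\<^sup>1\<^sup>/\<^sup>3\<close>, and write \<open>\<omega>\<close> for the volume of the unit
  ball. The ratio is \<open>V(t) / (\<omega> R(t)\<^sup>3)\<close>, where \<open>R(t) = R + (t - \<epsilon>)\<close> is half the width, so the
  derivative at \<open>\<epsilon>\<close> is nonnegative exactly when \<open>V' R \<ge> 3 V\<close>. Three consequences of the
  Brunn-Minkowski inequality are combined.

  \<^item> As \<open>(1 - u) (K + s B) + u (K + t B) \<subseteq> K + ((1 - u) s + u t) B\<close>, the function \<open>g\<close> is concave. It
    therefore has a supporting line from above, of some slope \<open>b\<close>, at \<open>\<epsilon>\<close>.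
  \<^item> As \<open>K + t B = (K + s B) + (t - s) B\<close>, the function \<open>g\<close> grows at least at the rate \<open>\<omega>\<^sup>1\<^sup>/\<^sup>3\<close>, so
    \<open>b \<ge> \<omega>\<^sup>1\<^sup>/\<^sup>3\<close>.
  \<^item> A set of diameter at most \<open>2 R\<close> has volume at most \<open>\<omega> R\<^sup>3\<close> (\<open>isodiametric_inequality\<close>), and the
    diameter of a body of constant width is its width, so \<open>g \<le> R \<omega>\<^sup>1\<^sup>/\<^sup>3\<close>.

  If \<open>V\<close> is differentiable at \<open>\<epsilon>\<close>, then \<open>V' = 3 g\<^sup>2 b\<close>, and \<open>V' R = 3 g\<^sup>2 b R \<ge> 3 g\<^sup>3 = 3 V\<close> as required.

  Differentiability follows by squeezing \<open>V\<close> between two smooth functions. By concavity \<open>V\<close> lies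
  below the smooth function
  \<open>q(t) = (g(\<epsilon>) + b (t - \<epsilon>))\<^sup>3\<close>, with equality at \<open>\<epsilon>\<close>. In the other direction the shell between two
  parallel surfaces becomes larger as it moves outwards, because moving along the outer normals of
  a convex set does not decrease distances. This gives \<open>V(\<epsilon> + h) + V(\<epsilon> - h) \<ge> 2 V(\<epsilon>)\<close>
  (\<open>parallel_volume_second_difference\<close>), so \<open>V(t) \<ge> 2 q(\<epsilon>) - q(2 \<epsilon> - t)\<close>. Both bounds have the same
  value and the same derivative at \<open>\<epsilon>\<close>.

  The Brunn-Minkowski inequality itself is proved by the method of Hadwiger and Ohmann: it is the
  inequality of arithmetic and geometric means for two boxes, it extends to finite disjoint unions
  of boxes by cutting along hyperplanes, and to open sets by exhaustion. All
  volume estimates hold in any dimension \<open>n\<close>, with \<open>n\<close>-th roots in place of cube roots.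
\<close>

section \<open>Minkowski sums of boxes\<close>

text \<open>
  Dividing by the right-hand side turns the two summands into geometric means of the ratios
  \<open>p i / (p i + q i)\<close> and \<open>q i / (p i + q i)\<close>. The corresponding arithmetic means add up to 1.
\<close>

lemma root_prod_superadditive:
  fixes p q :: "'i \<Rightarrow> real"
  assumes S: "finite S" "S \<noteq> {}" and p: "\<And>i. i \<in> S \<Longrightarrow> p i > 0" and q: "\<And>i. i \<in> S \<Longrightarrow> q i > 0"
  shows "root (card S) (\<Prod>i\<in>S. p i) + root (card S) (\<Prod>i\<in>S. q i)
         \<le> root (card S) (\<Prod>i\<in>S. p i + q i)"
proof -
  define n where "n = card S"
  have n: "n > 0" using S by (simp add: n_def card_gt_0_iff)
  have AG: "root n (\<Prod>i\<in>S. f i) \<le> (\<Sum>i\<in>S. f i / n)" if "\<And>i. i \<in> S \<Longrightarrow> f i > 0" for f :: "'i \<Rightarrow> real"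
  proof -
    have "(\<Prod>i\<in>S. f i) > 0" using that by (simp add: prod_pos)
    then show ?thesis
      using arith_geom_mean[OF S, of f] that n
      by (simp add: root_powr_inverse n_def less_imp_le)
  qed
  define s where "s i = p i + q i" for i
  have s: "s i > 0" if "i \<in> S" for i using p[OF that] q[OF that] by (simp add: s_def)
  have Ps: "root n (\<Prod>i\<in>S. s i) > 0" using n s by (simp add: prod_pos)
  have "root n (\<Prod>i\<in>S. p i / s i) + root n (\<Prod>i\<in>S. q i / s i)
      \<le> (\<Sum>i\<in>S. p i / s i / n) + (\<Sum>i\<in>S. q i / s i / n)"
    using p q s by (intro add_mono AG) auto
  also have "\<dots> = (\<Sum>i\<in>S. 1 / n)"
    unfolding sum.distrib[symmetric]
  proof (rule sum.cong[OF refl])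
    fix i assume "i \<in> S"
    from s[OF this] show "p i / s i / n + q i / s i / n = 1 / n"
      by (simp add: add_divide_distrib[symmetric] s_def[symmetric])
  qed
  also have "\<dots> = 1" using n by (simp add: n_def)
  finally have "(root n (\<Prod>i\<in>S. p i) + root n (\<Prod>i\<in>S. q i)) / root n (\<Prod>i\<in>S. s i) \<le> 1"
    by (simp add: prod_dividef real_root_divide add_divide_distrib)
  with Ps show ?thesis by (simp add: n_def s_def)
qed

text \<open>
  Each point of the large box is split by dividing its position in every coordinate interval in the
  proportion of the two side lengths.
\<close>

lemma box_subset_set_plus:
  fixes a b c d :: "'a::euclidean_space"
  assumes "box a b \<noteq> {}" "box c d \<noteq> {}"
  shows "box (a + c) (b + d) \<subseteq> box a b + box c d"
proof
  fix z assume z: "z \<in> box (a + c) (b + d)"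
  have ab: "a \<bullet> i < b \<bullet> i" and cd: "c \<bullet> i < d \<bullet> i" if "i \<in> Basis" for i
    using assms that by (auto simp: box_ne_empty)
  define l where "l i = (z \<bullet> i - (a + c) \<bullet> i) / ((b - a) \<bullet> i + (d - c) \<bullet> i)" for i
  define x where "x = (\<Sum>i\<in>Basis. (a \<bullet> i + l i * ((b - a) \<bullet> i)) *\<^sub>R i)"
  have l: "0 < l i" "l i < 1" if "i \<in> Basis" for i
    using z ab[OF that] cd[OF that] that
    by (auto simp: l_def mem_box inner_simps field_simps)
  have x: "x \<bullet> i = a \<bullet> i + l i * ((b - a) \<bullet> i)" if "i \<in> Basis" for i
    using that by (simp add: x_def)
  have zx: "(z - x) \<bullet> i = c \<bullet> i + l i * ((d - c) \<bullet> i)" if i: "i \<in> Basis" for i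
  proof -
    have "l i * ((b - a) \<bullet> i + (d - c) \<bullet> i) = z \<bullet> i - (a + c) \<bullet> i"
      using ab[OF i] cd[OF i] by (simp add: l_def inner_simps)
    then show ?thesis by (simp add: x[OF i] inner_simps algebra_simps)
  qed
  have betw: "u < u + t * (v - u) \<and> u + t * (v - u) < v" if "0 < t" "t < 1" "u < v" for u v t :: real
  proof -
    have "0 < t * (v - u)" "t * (v - u) < 1 * (v - u)"
      using that by (auto intro!: mult_strict_right_mono)
    then show ?thesis by simp
  qed
  have "x \<in> box a b"
    using betw l ab x by (auto simp: mem_box inner_diff_left)
  moreover have "z - x \<in> box c d"
    using betw l cd zx by (auto simp: mem_box inner_diff_left[of d c])
  ultimately show "z \<in> box a b + box c d"
    unfolding set_plus_def by (intro CollectI bexI[of _ x] bexI[of _ "z - x"]) auto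
qed

lemma open_set_plus: "open A \<Longrightarrow> open (A + B)" for A B :: "'a::real_normed_vector set"
proof -
  assume "open A"
  then have "open (\<Union>b\<in>B. (+) b ` A)" by (intro open_UN ballI open_translation)
  also have "(\<Union>b\<in>B. (+) b ` A) = A + B" by (force simp: set_plus_def add.commute)
  finally show ?thesis .
qed

lemma bounded_set_plus: "bounded A \<Longrightarrow> bounded B \<Longrightarrow> bounded (A + B)" for A B :: "'a::real_normed_vector set"
proof -
  assume "bounded A" "bounded B"
  then have "bounded (\<Union>x\<in>A. \<Union>y\<in>B. {x + y})" by (rule bounded_sums)
  also have "(\<Union>x\<in>A. \<Union>y\<in>B. {x + y}) = A + B" by (auto simp: set_plus_def)
  finally show ?thesis .
qed

text \<open>
  For two boxes the Brunn-Minkowski inequality is the superadditivity of geometric means, applied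
  to the side lengths.
\<close>

lemma brunn_minkowski_box:
  fixes a b c d :: "'a::euclidean_space"
  assumes ne: "box a b \<noteq> {}" "box c d \<noteq> {}"
  shows "(root DIM('a) (measure lebesgue (box a b)) + root DIM('a) (measure lebesgue (box c d))) ^ DIM('a)
         \<le> measure lebesgue (box a b + box c d)"
proof -
  have ab: "a \<bullet> i < b \<bullet> i" and cd: "c \<bullet> i < d \<bullet> i" if "i \<in> Basis" for i
    using ne that by (auto simp: box_ne_empty)
  have m: "measure lebesgue (box u v) = (\<Prod>i\<in>Basis. (v - u) \<bullet> i)"
    if "\<And>i. i \<in> Basis \<Longrightarrow> u \<bullet> i < v \<bullet> i" for u v :: 'a
    using that by (auto simp: measure_lborel_box_eq less_imp_le)
  have "root DIM('a) (measure lebesgue (box a b)) + root DIM('a) (measure lebesgue (box c d))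
     \<le> root DIM('a) (measure lebesgue (box (a + c) (b + d)))"
    using root_prod_superadditive[of "Basis :: 'a set" "\<lambda>i. (b - a) \<bullet> i" "\<lambda>i. (d - c) \<bullet> i"] ab cd
    by (subst (1 2 3) m) (simp_all add: inner_simps add_strict_mono algebra_simps)
  then have "(root DIM('a) (measure lebesgue (box a b)) + root DIM('a) (measure lebesgue (box c d))) ^ DIM('a)
     \<le> root DIM('a) (measure lebesgue (box (a + c) (b + d))) ^ DIM('a)"
    by (intro power_mono add_nonneg_nonneg) auto
  also have "\<dots> = measure lebesgue (box (a + c) (b + d))" by simp
  also have "\<dots> \<le> measure lebesgue (box a b + box c d)"
    by (intro measure_mono_fmeasurable box_subset_set_plus ne lmeasurable_open
        open_set_plus bounded_set_plus bounded_box open_box) auto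
  finally show ?thesis .
qed

section \<open>Cutting sets and unions of boxes by hyperplanes\<close>

lemma measure_split_hyperplane:
  fixes S :: "'a::euclidean_space set"
  assumes "S \<in> lmeasurable" "i \<noteq> 0"
  shows "measure lebesgue S = measure lebesgue (S \<inter> {x. x \<bullet> i < c}) + measure lebesgue (S \<inter> {x. x \<bullet> i > c})"
proof -
  have o: "open {x. x \<bullet> i < c}" "open {x. x \<bullet> i > c}"
    by (auto intro!: open_Collect_less continuous_intros)
  have l: "S \<inter> {x. x \<bullet> i < c} \<in> lmeasurable" "S \<inter> {x. x \<bullet> i > c} \<in> lmeasurable"
    using o assms by (auto intro!: fmeasurable_Int_fmeasurable)
  have "negligible {x. i \<bullet> x = c}" using assms by (simp add: negligible_hyperplane)
  then have "negligible ((S - (S \<inter> {x. x \<bullet> i < c} \<union> S \<inter> {x. x \<bullet> i > c}))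
      \<union> ((S \<inter> {x. x \<bullet> i < c} \<union> S \<inter> {x. x \<bullet> i > c}) - S))"
    by (rule negligible_subset) (auto simp: inner_commute)
  then have "measure lebesgue S = measure lebesgue ((S \<inter> {x. x \<bullet> i < c}) \<union> (S \<inter> {x. x \<bullet> i > c}))"
    by (rule measure_negligible_symdiff[OF assms(1), symmetric])
  also have "\<dots> = measure lebesgue (S \<inter> {x. x \<bullet> i < c}) + measure lebesgue (S \<inter> {x. x \<bullet> i > c})"
    using l by (intro measure_Union) (auto simp: fmeasurable_def)
  finally show ?thesis .
qed

text \<open>
  The volume cut off by a moving hyperplane is the distribution function of the image of Lebesgue
  measure on \<open>S\<close> under \<open>x \<mapsto> x \<bullet> i\<close>. Hyperplanes are null sets, so this function has no jumps and
  the intermediate value theorem applies.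
\<close>

lemma halfspace_cut_exists:
  fixes S :: "'a::euclidean_space set"
  assumes S: "open S" "bounded S" and i: "i \<noteq> 0" and \<theta>: "0 < \<theta>" "\<theta> < 1" 
    and pos: "measure lebesgue S > 0"
  obtains c where "measure lebesgue (S \<inter> {x. x \<bullet> i < c}) = \<theta> * measure lebesgue S"
proof -
  have lS: "S \<in> fmeasurable lborel" using S lmeasurable_open[OF S(2,1)] by (simp add: fmeasurable_def)
  define M where "M = distr (restrict_space lborel S) borel (\<lambda>x. x \<bullet> i)"
  have meas: "(\<lambda>x. x \<bullet> i) \<in> measurable (restrict_space lborel S) borel"
    by (intro measurable_restrict_space1) simp
  have ms: "measure M T = measure lebesgue (S \<inter> {x. x \<bullet> i \<in> T})" if T: "T \<in> sets borel" for T
  proof -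
    have b: "{x. x \<bullet> i \<in> T} \<in> sets borel"
      using T measurable_sets_borel[of "\<lambda>x. x \<bullet> i" borel T] by (simp add: vimage_def)
    have "measure M T = measure (restrict_space lborel S) (S \<inter> {x. x \<bullet> i \<in> T})"
      unfolding M_def using T meas
      by (subst measure_distr) (auto simp: space_restrict_space vimage_def Int_def conj_commute)
    also have "\<dots> = measure lborel (S \<inter> {x. x \<bullet> i \<in> T})"
      using S by (intro measure_restrict_space) auto
    finally show ?thesis using S b by simp
  qed
  have fin: "emeasure M (space M) \<noteq> \<infinity>"
    using meas lS S
    by (simp add: M_def emeasure_distr space_restrict_space emeasure_restrict_space fmeasurable_def)
  have "sets M = sets borel" by (simp add: M_def)
  then interpret finite_borel_measure M
    by (rule finite_borel_measure.intro[OF finite_measureI[OF fin] finite_borel_measure_axioms.intro])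
  have "isCont (cdf M) x" for x
  proof -
    have "negligible (S \<inter> {y. i \<bullet> y = x})"
      using negligible_hyperplane[of i x] i by (auto intro: negligible_subset)
    then show ?thesis
      by (simp add: isCont_cdf ms inner_commute negligible_imp_measure0)
  qed
  then have cont: "continuous_on UNIV (cdf M)"
    by (simp add: continuous_on_eq_continuous_at)
  have "measure lebesgue S = measure M (space M)"
    using ms[of UNIV] by (simp add: M_def)
  then have top: "(cdf M \<longlongrightarrow> measure lebesgue S) at_top" using cdf_lim_at_top by simp
  have "\<theta> * measure lebesgue S < measure lebesgue S" "0 < \<theta> * measure lebesgue S"
    using \<theta> pos by auto
  then have ev: "eventually (\<lambda>c. cdf M c > \<theta> * measure lebesgue S) at_top" 
            "eventually (\<lambda>c. cdf M c < \<theta> * measure lebesgue S) at_bot"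
    using order_tendstoD[OF top] order_tendstoD[OF cdf_lim_at_bot] by auto
  obtain hi where hi: "\<And>c. c \<ge> hi \<Longrightarrow> cdf M c > \<theta> * measure lebesgue S"
    using ev(1) by (auto simp: eventually_at_top_linorder)
  obtain lo where lo: "\<And>c. c \<le> lo \<Longrightarrow> cdf M c < \<theta> * measure lebesgue S"
    using ev(2) by (auto simp: eventually_at_bot_linorder)
  have "lo \<le> hi" using lo[of "min lo hi"] hi[of hi] lo[of hi] by (smt (verit))
  then obtain c where c: "cdf M c = \<theta> * measure lebesgue S"
    using IVT'[of "cdf M" lo "\<theta> * measure lebesgue S" hi] lo[of lo] hi[of hi]
      continuous_on_subset[OF cont] by (auto simp: less_imp_le)
  have "measure lebesgue (S \<inter> {x. x \<bullet> i \<le> c}) = measure lebesgue (S \<inter> {x. x \<bullet> i < c})"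
  proof (rule measure_negligible_symdiff)
    have "open {x. x \<bullet> i < c}" by (auto intro!: open_Collect_less continuous_intros)
    then show "S \<inter> {x. x \<bullet> i < c} \<in> lmeasurable"
      using S by (intro lmeasurable_open) auto
    show "negligible (S \<inter> {x. x \<bullet> i < c} - S \<inter> {x. x \<bullet> i \<le> c}
         \<union> (S \<inter> {x. x \<bullet> i \<le> c} - S \<inter> {x. x \<bullet> i < c}))"
      by (rule negligible_subset[OF negligible_hyperplane[of i c]]) (use i in \<open>auto simp: inner_commute\<close>)
  qed
  then show thesis using that c by (simp add: cdf_def ms)
qed

text \<open>
  The number of boxes is the induction measure for the Brunn-Minkowski inequality. It is kept as an
  upper bound, so that the boxes lost in a cut need not be counted. The boxes are open, so a cut
  into two open halves yields boxes of the same kind that are disjoint outright.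
\<close>

definition box_union :: "nat \<Rightarrow> 'a::euclidean_space set \<Rightarrow> bool" where
  "box_union k S \<longleftrightarrow> (\<exists>\<D>. finite \<D> \<and> card \<D> \<le> k \<and> pairwise disjnt \<D> \<and>
     (\<forall>D\<in>\<D>. D \<noteq> {} \<and> (\<exists>a b. D = box a b)) \<and> S = \<Union>\<D>)"

lemma box_union_mono: "box_union k S \<Longrightarrow> k \<le> l \<Longrightarrow> box_union l S"
proof -
  assume "box_union k S" "k \<le> l"
  then obtain \<D> where "finite \<D>" "card \<D> \<le> k" "pairwise disjnt \<D>"
     "\<forall>D\<in>\<D>. D \<noteq> {} \<and> (\<exists>a b. D = box a b)" "S = \<Union>\<D>"
    unfolding box_union_def by (elim exE conjE)
  with \<open>k \<le> l\<close> show "box_union l S"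
    unfolding box_union_def by (intro exI[of _ \<D>] conjI order_trans[of "card \<D>" k l])
qed

lemma box_union_open_bounded:
  assumes "box_union k S" shows "open S" "bounded S"
proof -
  obtain \<D> where D: "finite \<D>" "\<And>D. D \<in> \<D> \<Longrightarrow> \<exists>a b. D = box a b" "S = \<Union>\<D>"
    using assms unfolding box_union_def by auto
  have "open D" "bounded D" if "D \<in> \<D>" for D using D(2)[OF that] by auto
  then show "open S" "bounded S" using D(1,3) by auto
qed

lemma box_Int_halfspace:
  fixes a b :: "'a::euclidean_space"
  assumes "i \<in> Basis"
  shows "\<exists>u v. box a b \<inter> {x. x \<bullet> i < c} = box u v" "\<exists>u v. box a b \<inter> {x. x \<bullet> i > c} = box u v"
proof -
  have "box a b \<inter> {x. x \<bullet> i < c} = box a (\<Sum>j\<in>Basis. (if j = i then min (b \<bullet> j) c else b \<bullet> j) *\<^sub>R j)"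
    using assms by (auto simp: mem_box split: if_splits)
  moreover have "box a b \<inter> {x. x \<bullet> i > c} = box (\<Sum>j\<in>Basis. (if j = i then max (a \<bullet> j) c else a \<bullet> j) *\<^sub>R j) b"
    using assms by (auto simp: mem_box split: if_splits)
  ultimately show "\<exists>u v. box a b \<inter> {x. x \<bullet> i < c} = box u v" "\<exists>u v. box a b \<inter> {x. x \<bullet> i > c} = box u v"
    by blast+
qed

text \<open>
  Boxes that miss \<open>H\<close> disappear, so the count drops as soon as there is one such box.
\<close>

lemma box_union_Int:
  fixes H :: "'a::euclidean_space set"
  assumes fin: "finite \<D>" and dis: "pairwise disjnt \<D>"
    and H: "\<And>D. D \<in> \<D> \<Longrightarrow> \<exists>a b. D \<inter> H = box a b"
  shows "box_union (card \<D>) (\<Union>\<D> \<inter> H)"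
    and "D0 \<in> \<D> \<Longrightarrow> D0 \<inter> H = {} \<Longrightarrow> box_union (card \<D> - 1) (\<Union>\<D> \<inter> H)"
proof -
  define \<E> where "\<E> = (\<lambda>D. D \<inter> H) ` {D \<in> \<D>. D \<inter> H \<noteq> {}}"
  have E: "finite \<E>" "pairwise disjnt \<E>" "\<forall>D\<in>\<E>. D \<noteq> {} \<and> (\<exists>a b. D = box a b)" "\<Union>\<D> \<inter> H = \<Union>\<E>"
  proof -
    show "finite \<E>" using fin by (simp add: \<E>_def)
    show "pairwise disjnt \<E>" using dis unfolding pairwise_def disjnt_def \<E>_def by blast
    show "\<forall>D\<in>\<E>. D \<noteq> {} \<and> (\<exists>a b. D = box a b)" using H unfolding \<E>_def by blast
    show "\<Union>\<D> \<inter> H = \<Union>\<E>" unfolding \<E>_def by blast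
  qed
  have le: "card \<E> \<le> card {D \<in> \<D>. D \<inter> H \<noteq> {}}" unfolding \<E>_def using fin by (intro card_image_le) auto
  show "box_union (card \<D>) (\<Union>\<D> \<inter> H)"
    unfolding box_union_def using E le card_mono[OF fin, of "{D \<in> \<D>. D \<inter> H \<noteq> {}}"]
    by (intro exI[of _ \<E>]) auto
  assume D0: "D0 \<in> \<D>" "D0 \<inter> H = {}"
  then have "card {D \<in> \<D>. D \<inter> H \<noteq> {}} \<le> card (\<D> - {D0})"
    using fin by (intro card_mono) auto
  with D0 fin have "card \<E> \<le> card \<D> - 1" using le by simp
  then show "box_union (card \<D> - 1) (\<Union>\<D> \<inter> H)"
    unfolding box_union_def using E by (intro exI[of _ \<E>]) auto
qed

lemma box_union_cut:
  fixes S :: "'a::euclidean_space set"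
  assumes "box_union k S" "i \<in> Basis"
  shows "box_union k (S \<inter> {x. x \<bullet> i < c})" "box_union k (S \<inter> {x. x \<bullet> i > c})"
proof -
  obtain \<D> where D: "finite \<D>" "card \<D> \<le> k" "pairwise disjnt \<D>"
      "\<forall>D\<in>\<D>. D \<noteq> {} \<and> (\<exists>a b. D = box a b)" "S = \<Union>\<D>"
    using assms unfolding box_union_def by blast
  have "box_union (card \<D>) (\<Union>\<D> \<inter> {x. x \<bullet> i < c})" "box_union (card \<D>) (\<Union>\<D> \<inter> {x. x \<bullet> i > c})"
    using D(4) box_Int_halfspace[OF assms(2)] by (auto intro!: box_union_Int(1) D(1,3))
  then show "box_union k (S \<inter> {x. x \<bullet> i < c})" "box_union k (S \<inter> {x. x \<bullet> i > c})"
    using D box_union_mono by auto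
qed

text \<open>
  Two disjoint boxes are separated by a hyperplane orthogonal to some basis vector. Each side then
  misses one of the two boxes, so both halves consist of fewer boxes than \<open>S\<close>.
\<close>

lemma box_union_separate:
  fixes S :: "'a::euclidean_space set"
  assumes "box_union (Suc (Suc k)) S" "\<not> box_union 1 S"
  obtains i c where "i \<in> Basis" "box_union (Suc k) (S \<inter> {x. x \<bullet> i < c})" "box_union (Suc k) (S \<inter> {x. x \<bullet> i > c})"
    "S \<inter> {x. x \<bullet> i < c} \<noteq> {}" "S \<inter> {x. x \<bullet> i > c} \<noteq> {}"
proof -
  note separated = that
  obtain \<D> where D: "finite \<D>" "card \<D> \<le> Suc (Suc k)" "pairwise disjnt \<D>"
      "\<And>D. D\<in>\<D> \<Longrightarrow> D \<noteq> {}" "\<And>D. D\<in>\<D> \<Longrightarrow> (\<exists>a b. D = box a b)" "S = \<Union>\<D>"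
    using assms(1) unfolding box_union_def by blast
  have "\<not> card \<D> \<le> 1"
    using D assms(2) unfolding box_union_def by blast
  then obtain D1 D2 where D12: "D1 \<in> \<D>" "D2 \<in> \<D>" "D1 \<noteq> D2"
    using D(1) by (metis card_le_Suc0_iff_eq One_nat_def)
  have sep: thesis if "D1 \<in> \<D>" "D2 \<in> \<D>" "i \<in> Basis" "D1 = box a b" "D2 = box u v" "b \<bullet> i \<le> u \<bullet> i" for D1 D2 a b u v i
  proof (rule separated[of i "b \<bullet> i"])
    have e: "D2 \<inter> {x. x \<bullet> i < b \<bullet> i} = {}" "D1 \<inter> {x. x \<bullet> i > b \<bullet> i} = {}"
      using that by (fastforce simp: mem_box)+
    have ne: "D1 \<noteq> {}" "D2 \<noteq> {}" using D(4) that by auto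
    have "D1 \<subseteq> {x. x \<bullet> i < b \<bullet> i}" "D2 \<subseteq> {x. x \<bullet> i > b \<bullet> i}"
      using that by (fastforce simp: mem_box)+
    with ne that D(6) show "S \<inter> {x. x \<bullet> i < b \<bullet> i} \<noteq> {}" "S \<inter> {x. x \<bullet> i > b \<bullet> i} \<noteq> {}" by blast+
    have H: "\<exists>a b. D \<inter> {x. x \<bullet> i < c} = box a b" "\<exists>a b. D \<inter> {x. x \<bullet> i > c} = box a b" if "D \<in> \<D>" for D c
      using D(5)[OF that] box_Int_halfspace[OF \<open>i \<in> Basis\<close>] by blast+
    have "box_union (card \<D> - 1) (S \<inter> {x. x \<bullet> i < b \<bullet> i})" "box_union (card \<D> - 1) (S \<inter> {x. x \<bullet> i > b \<bullet> i})"
      unfolding D(6) using box_union_Int(2)[OF D(1,3) H(1) that(2) e(1)]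
        box_union_Int(2)[OF D(1,3) H(2) that(1) e(2)] by auto
    then show "box_union (Suc k) (S \<inter> {x. x \<bullet> i < b \<bullet> i})" "box_union (Suc k) (S \<inter> {x. x \<bullet> i > b \<bullet> i})"
      using D(2) by (auto elim!: box_union_mono)
  qed (fact \<open>i \<in> Basis\<close>)
  obtain a b where ab: "D1 = box a b" using D(5) D12 by blast
  obtain u v where uv: "D2 = box u v" using D(5) D12 by blast
  have "box a b \<inter> box u v = {}" using D(3) D12 ab uv by (auto simp: pairwise_def disjnt_def)
  moreover have "box a b \<noteq> {}" "box u v \<noteq> {}" using D(4) D12 ab uv by auto
  ultimately obtain i where "i \<in> Basis" "b \<bullet> i \<le> u \<bullet> i \<or> v \<bullet> i \<le> a \<bullet> i"
    unfolding disjoint_interval box_ne_empty by (meson not_le)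
  then show thesis using sep[of D1 D2 i a b u v] sep[of D2 D1 i u v a b] D12 ab uv by blast
qed

section \<open>The Brunn-Minkowski inequality\<close>

lemma measure_pos_open: "open S \<Longrightarrow> bounded S \<Longrightarrow> S \<noteq> {} \<Longrightarrow> measure lebesgue S > 0"
  for S :: "'a::euclidean_space set"
proof -
  assume S: "open S" "bounded S" "S \<noteq> {}"
  then have "measure lebesgue S \<noteq> 0"
    using open_not_negligible[of S] lmeasurable_open[of S] by (simp add: negligible_iff_measure)
  then show "measure lebesgue S > 0" using measure_nonneg[of lebesgue S] by linarith
qed

lemma root_sum_power_homogeneous:
  assumes "n > 0" "\<theta> \<ge> 0" "x \<ge> 0" "y \<ge> 0"
  shows "(root n (\<theta> * x) + root n (\<theta> * y)) ^ n = \<theta> * (root n x + root n y) ^ n"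
proof -
  have "root n (\<theta> * x) + root n (\<theta> * y) = root n \<theta> * (root n x + root n y)"
    by (simp add: real_root_mult algebra_simps)
  then show ?thesis using assms by (simp add: power_mult_distrib)
qed

text \<open>
  The induction of Hadwiger and Ohmann on the total number of boxes. A set consisting of several
  boxes is cut so that both halves have fewer boxes, and the other set is cut by a parallel hyperplane
  in the same proportion \<open>\<theta>\<close>. The sums of corresponding halves lie on different sides of a third
  hyperplane, so their volumes add up. Since the proportions agree, the two lower bounds given by the
  induction hypothesis add up to the bound for the whole sets.
\<close>

lemma brunn_minkowski_box_union:
  fixes A B :: "'a::euclidean_space set"
  assumes "box_union k A" "box_union l B" "A \<noteq> {}" "B \<noteq> {}"
  shows "(root DIM('a) (measure lebesgue A) + root DIM('a) (measure lebesgue B)) ^ DIM('a)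
         \<le> measure lebesgue (A + B)"
  using assms
proof (induction "k + l" arbitrary: k l A B rule: less_induct)
  case less
  define n where "n = DIM('a)"
  have n: "n > 0" by (simp add: n_def)
  let ?m = "measure lebesgue :: 'a set \<Rightarrow> real"
  have cut: "(root n (?m A) + root n (?m B)) ^ n \<le> ?m (A + B)"
    if u: "box_union (Suc (Suc k)) A" "\<not> box_union 1 A" "box_union l B" "A \<noteq> {}" "B \<noteq> {}"
      and IH: "\<And>A' B'. box_union (Suc k) A' \<Longrightarrow> box_union l B' \<Longrightarrow> A' \<noteq> {} \<Longrightarrow> B' \<noteq> {}
         \<Longrightarrow> (root n (?m A') + root n (?m B')) ^ n \<le> ?m (A' + B')"
    for A B :: "'a set" and k l
  proof -
    obtain i c where i: "i \<in> Basis" and 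
      bu: "box_union (Suc k) (A \<inter> {x. x \<bullet> i < c})" "box_union (Suc k) (A \<inter> {x. x \<bullet> i > c})"
      and ne: "A \<inter> {x. x \<bullet> i < c} \<noteq> {}" "A \<inter> {x. x \<bullet> i > c} \<noteq> {}"
      using box_union_separate[OF u(1,2)] by blast
    let ?A1 = "A \<inter> {x. x \<bullet> i < c}" and ?A2 = "A \<inter> {x. x \<bullet> i > c}"
    have i0: "i \<noteq> 0" using i by auto
    have ob: "open A" "bounded A" "open B" "bounded B"
      using u box_union_open_bounded by blast+
    have pos: "?m A > 0" "?m B > 0" "?m ?A1 > 0" "?m ?A2 > 0"
      using measure_pos_open ob u ne bu box_union_open_bounded by blast+
    have mA: "?m A = ?m ?A1 + ?m ?A2"
      using measure_split_hyperplane[OF lmeasurable_open i0] ob by blast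
    define \<theta> where "\<theta> = ?m ?A1 / ?m A"
    have \<theta>: "0 < \<theta>" "\<theta> < 1" using pos mA by (auto simp: \<theta>_def)
    have A12: "?m ?A1 = \<theta> * ?m A" "?m ?A2 = (1 - \<theta>) * ?m A"
      using pos mA by (auto simp: \<theta>_def field_simps)
    obtain d where d: "?m (B \<inter> {x. x \<bullet> i < d}) = \<theta> * ?m B"
      using halfspace_cut_exists[OF ob(3,4) i0 \<theta> pos(2)] by blast
    let ?B1 = "B \<inter> {x. x \<bullet> i < d}" and ?B2 = "B \<inter> {x. x \<bullet> i > d}"
    have mB: "?m B = ?m ?B1 + ?m ?B2"
      using measure_split_hyperplane[OF lmeasurable_open i0] ob by blast
    have B2: "?m ?B2 = (1 - \<theta>) * ?m B" using mB d by (simp add: algebra_simps)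
    have neB: "?B1 \<noteq> {}" "?B2 \<noteq> {}" using d B2 \<theta> pos by force+
    note bB = box_union_cut[OF u(3) i, of d]
    have ob': "?A1 + ?B1 \<in> lmeasurable" "?A2 + ?B2 \<in> lmeasurable" "A + B \<in> lmeasurable"
      using box_union_open_bounded bu bB ob
      by (blast intro: lmeasurable_open open_set_plus bounded_set_plus)+
    have "(root n (?m A) + root n (?m B)) ^ n
      = \<theta> * (root n (?m A) + root n (?m B)) ^ n + (1 - \<theta>) * (root n (?m A) + root n (?m B)) ^ n"
      by (simp add: algebra_simps)
    also have "\<dots> = (root n (?m ?A1) + root n (?m ?B1)) ^ n + (root n (?m ?A2) + root n (?m ?B2)) ^ n"
      unfolding A12 d B2 using n \<theta> pos by (simp only: root_sum_power_homogeneous)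
    also have "\<dots> \<le> ?m (?A1 + ?B1) + ?m (?A2 + ?B2)"
      using IH bu bB ne neB by (intro add_mono) auto
    also have "\<dots> = ?m ((?A1 + ?B1) \<union> (?A2 + ?B2))"
    proof (rule measure_Union[symmetric])
      have "x \<bullet> i < c + d" if "x \<in> ?A1 + ?B1" for x
        using that by (auto simp: set_plus_def inner_simps)
      moreover have "x \<bullet> i > c + d" if "x \<in> ?A2 + ?B2" for x
        using that by (auto simp: set_plus_def inner_simps)
      ultimately show "(?A1 + ?B1) \<inter> (?A2 + ?B2) = {}" by fastforce
    qed (use ob' in \<open>auto simp: fmeasurable_def\<close>)
    also have "\<dots> \<le> ?m (A + B)"
      using ob' by (intro measure_mono_fmeasurable) (auto simp: set_plus_def)
    finally show ?thesis .
  qed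
  have base: "\<exists>a b. S = box a b" if "box_union 1 S" "S \<noteq> {}" for S :: "'a set"
  proof -
    obtain \<D> where D: "finite \<D>" "card \<D> \<le> 1" "\<And>D. D \<in> \<D> \<Longrightarrow> \<exists>a b. D = box a b" "S = \<Union>\<D>"
      using \<open>box_union 1 S\<close> unfolding box_union_def by auto
    have "\<D> \<noteq> {}" using D that by auto
    then obtain D where "\<D> = {D}" 
      using D by (metis One_nat_def card_1_singletonE card_gt_0_iff le_antisym Suc_leI)
    then show ?thesis using D by auto
  qed
  have size: "\<exists>k'. k = Suc (Suc k')" if "box_union k S" "\<not> box_union 1 S" for k and S :: "'a set"
  proof -
    have "\<not> k \<le> 1" using that box_union_mono by blast
    then show ?thesis by (metis One_nat_def Suc_leI le0 not0_implies_Suc le_numeral_extra(3) less_Suc_eq_le not_less_eq_eq)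
  qed
  show ?case
  proof (cases "box_union 1 A")
    case False
    obtain k' where k: "k = Suc (Suc k')" using size[OF less.prems(1) False] by blast
    show ?thesis
      using cut[OF less.prems(1)[unfolded k] False less.prems(2-4)] less.hyps[of "Suc k'" l] k
      by (simp add: n_def)
  next
    case A: True
    show ?thesis
    proof (cases "box_union 1 B")
      case False
      obtain l' where l: "l = Suc (Suc l')" using size[OF less.prems(2) False] by blast
      have IH: "(root n (?m B') + root n (?m A')) ^ n \<le> ?m (B' + A')"
        if "box_union (Suc l') B'" "box_union k A'" "B' \<noteq> {}" "A' \<noteq> {}" for A' B' :: "'a set"
        using less.hyps[of k "Suc l'" A' B'] that l
        by (simp add: n_def add.commute[of B'] add.commute[of "root DIM('a) (?m B')"])
      have "(root n (?m B) + root n (?m A)) ^ n \<le> ?m (B + A)"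
        using cut[OF less.prems(2)[unfolded l] False less.prems(1,4,3)] IH by blast
      then show ?thesis
        by (simp add: n_def add.commute[of B] add.commute[of "root DIM('a) (?m B)"])
    next
      case True
      then show ?thesis using base[OF A] base[OF True] less.prems brunn_minkowski_box by blast
    qed
  qed
qed

text \<open>
  An open set is a countable union of closed boxes. The partial unions are subdivided into boxes with
  disjoint interiors; passing to these interiors loses only a null set.
\<close>

lemma open_inner_box_union:
  fixes S :: "'a::euclidean_space set"
  assumes S: "open S" "bounded S" and e: "e > 0"
  obtains k T where "box_union k T" "T \<subseteq> S" "measure lebesgue T > measure lebesgue S - e"
proof -
  obtain \<D> where D: "countable \<D>" "\<D> \<subseteq> Pow S" "\<And>X. X \<in> \<D> \<Longrightarrow> \<exists>a b. X = cbox a b" "\<Union>\<D> = S"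
    using open_countable_Union_open_cbox[OF S(1)] by blast
  \<comment> \<open>The extra empty box makes the enumerated family nonempty.\<close>
  define X where "X = from_nat_into (insert {} \<D>)"
  have rX: "range X = insert {} \<D>"
    unfolding X_def using D(1) by (intro range_from_nat_into) auto
  have Xb: "\<exists>a b. X j = cbox a b" for j
  proof -
    have "X j \<in> insert {} \<D>" using rX by blast
    then show ?thesis
    proof
      assume "X j = {}"
      then show ?thesis using empty_as_interval by blast
    qed (rule D(3))
  qed
  define U where "U m = (\<Union>j<m. X j)" for m
  have "(\<Union>m. U m) = \<Union>(range X)"
    unfolding U_def by (auto intro: lessI)
  then have US: "(\<Union>m. U m) = S"
    using rX D(4) by simp
  have Um: "U m \<in> lmeasurable" for m
  proof -
    have "X j \<in> lmeasurable" for j using Xb[of j] by auto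
    then show ?thesis unfolding U_def by (intro fmeasurable.finite_UN) auto
  qed
  have "(\<lambda>m. measure lebesgue (U m)) \<longlonglongrightarrow> measure lebesgue (\<Union>m. U m)"
  proof (rule Lim_measure_incseq)
    show "range U \<subseteq> sets lebesgue" using Um by auto
    show "incseq U" unfolding U_def incseq_def by (auto intro: less_le_trans)
    show "emeasure lebesgue (\<Union> (range U)) \<noteq> \<infinity>"
      using lmeasurable_open[OF S(2,1)] US by (auto simp: fmeasurable_def)
  qed
  then have "eventually (\<lambda>m. measure lebesgue (U m) > measure lebesgue S - e) sequentially"
    unfolding US by (rule order_tendstoD) (use e in auto)
  then obtain m where m: "measure lebesgue (U m) > measure lebesgue S - e"
    by (auto simp: eventually_sequentially)
  have "\<exists>p. p division_of U m"
    unfolding U_def by (rule elementary_unions_intervals[of "X ` {..<m}"]) (use Xb in blast)+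
  then obtain p where p: "p division_of U m" by blast
  define \<E> where "\<E> = interior ` {K \<in> p. interior K \<noteq> {}}"
  have fp: "finite p" using p by (rule division_of_finite)
  have cb: "\<exists>a b. K = cbox a b" if "K \<in> p" for K using division_ofD(4)[OF p that] .
  have Up: "\<Union>p = U m" using division_ofD(6)[OF p] .
  have "box_union (card \<E>) (\<Union>\<E>)"
    unfolding box_union_def
  proof (intro exI[of _ \<E>] conjI ballI order_refl refl)
    show "finite \<E>" using fp by (simp add: \<E>_def)
    show "pairwise disjnt \<E>"
      using division_ofD(5)[OF p] unfolding pairwise_def disjnt_def \<E>_def by blast
    show "D \<noteq> {}" "\<exists>a b. D = box a b" if "D \<in> \<E>" for D
      using that cb interior_cbox unfolding \<E>_def by blast+
  qed
  moreover have "\<Union>\<E> \<subseteq> S"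
    using Up US interior_subset unfolding \<E>_def by blast
  moreover have "measure lebesgue (\<Union>\<E>) = measure lebesgue (U m)"
  proof (rule measure_negligible_symdiff[OF Um])
    have sub: "K - frontier K \<subseteq> \<Union>\<E>" if "K \<in> p" for K
      using that closure_subset[of K] unfolding \<E>_def frontier_def by blast
    have "\<Union>\<E> \<subseteq> U m" unfolding \<E>_def Up[symmetric] using interior_subset by fast
    moreover have "U m \<subseteq> \<Union>\<E> \<union> (\<Union>K\<in>p. frontier K)"
      unfolding Up[symmetric] using sub by blast
    ultimately have "U m - \<Union>\<E> \<union> (\<Union>\<E> - U m) \<subseteq> (\<Union>K\<in>p. frontier K)" by blast
    moreover have "negligible (\<Union>K\<in>p. frontier K)"
      using fp cb by (intro negligible_Union) (auto intro: negligible_convex_frontier convex_box)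
    ultimately show "negligible (U m - \<Union>\<E> \<union> (\<Union>\<E> - U m))" by (rule negligible_subset[rotated])
  qed
  ultimately show thesis using that m by metis
qed

theorem brunn_minkowski_open:
  fixes A B :: "'a::euclidean_space set"
  assumes A: "open A" "bounded A" "A \<noteq> {}" and B: "open B" "bounded B" "B \<noteq> {}"
  shows "root DIM('a) (measure lebesgue A) + root DIM('a) (measure lebesgue B)
         \<le> root DIM('a) (measure lebesgue (A + B))"
proof -
  define n where "n = DIM('a)"
  have n: "n > 0" by (simp add: n_def)
  let ?m = "measure lebesgue :: 'a set \<Rightarrow> real"
  have pos: "?m A > 0" "?m B > 0" using measure_pos_open A B by blast+
  have step: "root n (?m A - e) + root n (?m B - e) \<le> root n (?m (A + B))"
    if e: "e > 0" "e < ?m A" "e < ?m B" for e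
  proof -
    obtain k A' where A': "box_union k A'" "A' \<subseteq> A" "?m A' > ?m A - e"
      using open_inner_box_union[OF A(1,2) e(1)] by blast
    obtain l B' where B': "box_union l B'" "B' \<subseteq> B" "?m B' > ?m B - e"
      using open_inner_box_union[OF B(1,2) e(1)] by blast
    have ne: "A' \<noteq> {}" "B' \<noteq> {}" using A'(3) B'(3) e by force+
    have le: "(root n (?m A') + root n (?m B')) ^ n \<le> ?m (A' + B')"
      unfolding n_def by (rule brunn_minkowski_box_union[OF A'(1) B'(1) ne])
    have "?m (A' + B') \<le> ?m (A + B)"
      by (intro measure_mono_fmeasurable fmeasurableD lmeasurable_open open_set_plus bounded_set_plus
          set_plus_mono2 A B A' B' box_union_open_bounded[OF A'(1)] box_union_open_bounded[OF B'(1)])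
    with le have "root n ((root n (?m A') + root n (?m B')) ^ n) \<le> root n (?m (A + B))"
      using n by (intro real_root_le_mono) auto
    then have "root n (?m A') + root n (?m B') \<le> root n (?m (A + B))"
      using n by (simp add: real_root_power_cancel)
    moreover have "root n (?m A - e) \<le> root n (?m A')" "root n (?m B - e) \<le> root n (?m B')"
      using n A' B' by (auto intro!: real_root_le_mono)
    ultimately show ?thesis by linarith
  qed
  have "((\<lambda>e. root n (?m A - e) + root n (?m B - e)) \<longlongrightarrow> root n (?m A - 0) + root n (?m B - 0)) (at_right 0)"
    by (intro tendsto_intros)
  moreover have "eventually (\<lambda>e. root n (?m A - e) + root n (?m B - e) \<le> root n (?m (A + B))) (at_right 0)"
    using eventually_at_right_less[of 0] eventually_at_right_real[OF pos(1)] eventually_at_right_real[OF pos(2)]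
    by eventually_elim (use step in auto)
  ultimately have "root n (?m A - 0) + root n (?m B - 0) \<le> root n (?m (A + B))"
    by (rule tendsto_upperbound) simp
  then show ?thesis by (simp add: n_def)
qed

section \<open>Maps that do not increase distances\<close>

text \<open>
  A ball of radius \<open>r\<close> is mapped into a ball of the same radius. Vitali's theorem covers \<open>S\<close> by
  disjoint balls up to a null set, whose image is again a null set. Coverings by balls are needed to
  obtain the constant 1: a cube is mapped into a set that need not fit into a cube of the same size.
\<close>

lemma emeasure_lipschitz_image_le:
  fixes f :: "'a::euclidean_space \<Rightarrow> 'a"
  assumes S: "open S" and fS: "f ` S \<in> sets lebesgue"
    and lip: "\<And>x y. x \<in> S \<Longrightarrow> y \<in> S \<Longrightarrow> dist (f x) (f y) \<le> dist x y"
  shows "emeasure lebesgue (f ` S) \<le> emeasure lebesgue S"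
proof -
  define K where "K = {(x, r). 0 < r \<and> ball x r \<subseteq> S}"
  have "\<exists>i. i \<in> K \<and> x \<in> ball (fst i) (snd i) \<and> snd i < d" if "x \<in> S" "d > 0" for x d
  proof -
    obtain e where e: "e > 0" "ball x e \<subseteq> S" using S \<open>x \<in> S\<close> openE by blast
    have "ball x (min e (d / 2)) \<subseteq> ball x e" by (simp add: subset_ball)
    then have "ball x (min e (d / 2)) \<subseteq> S" using e(2) by (rule subset_trans)
    then show ?thesis
      using e that by (intro exI[of _ "(x, min e (d/2))"]) (simp add: K_def min_less_iff_disj)
  qed
  then obtain C where C: "countable C" "C \<subseteq> K"
    and pw: "pairwise (\<lambda>i j. disjnt (ball (fst i) (snd i)) (ball (fst j) (snd j))) C"
    and neg: "negligible (S - (\<Union>i\<in>C. ball (fst i) (snd i)))"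
    by (rule Vitali_covering_theorem_balls[of S K fst snd])
  define c where "c n = from_nat_into C n" for n
  \<comment> \<open>Indices outside \<open>I\<close> pad a finite covering with empty sets.\<close>
  define I where "I = to_nat_on C ` C"
  define A where "A n = (if n \<in> I then ball (fst (c n)) (snd (c n)) else {})" for n
  define B where "B n = (if n \<in> I then ball (f (fst (c n))) (snd (c n)) else {})" for n
  have c: "c n \<in> C" if "n \<in> I" for n using that C by (auto simp: I_def c_def)
  have c': "fst (c n) \<in> S" "snd (c n) > 0" "ball (fst (c n)) (snd (c n)) \<subseteq> S" if "n \<in> I" for n
  proof -
    have "c n \<in> K" using c[OF that] C(2) by blast
    then show r: "snd (c n) > 0" "ball (fst (c n)) (snd (c n)) \<subseteq> S" by (auto simp: K_def split_beta)
    then show "fst (c n) \<in> S" by auto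
  qed
  have UA: "(\<Union>n. A n) = (\<Union>i\<in>C. ball (fst i) (snd i))"
    using C(1) by (force simp: A_def I_def c_def)
  have AB: "emeasure lebesgue (B n) = emeasure lebesgue (A n)" for n
    using c'(2)[of n] by (simp add: A_def B_def emeasure_ball less_imp_le)
  have fAB: "f ` A n \<subseteq> B n" for n
  proof (cases "n \<in> I")
    case True
    have "dist (f (fst (c n))) (f y) < snd (c n)" if "y \<in> ball (fst (c n)) (snd (c n))" for y
      using lip[OF c'(1)[OF True], of y] c'(3)[OF True] that by (meson mem_ball order_le_less_trans subsetD)
    then show ?thesis using True by (auto simp: A_def B_def)
  qed (simp add: A_def)
  have dA: "disjoint_family A"
    unfolding disjoint_family_on_def
  proof (intro ballI impI)
    fix m n :: nat assume "m \<noteq> n"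
    then have "c m \<noteq> c n" if "m \<in> I" "n \<in> I"
      using that C(1) by (auto simp: I_def c_def)
    then show "A m \<inter> A n = {}"
      using pw c by (auto simp: A_def pairwise_def disjnt_def)
  qed
  define N where "N = f ` (S - (\<Union>n. A n))"
  have "negligible N"
    unfolding N_def
  proof (rule negligible_locally_Lipschitz_image[OF order_refl])
    show "negligible (S - (\<Union>n. A n))" using neg UA by simp
    show "\<exists>T B. open T \<and> x \<in> T \<and> (\<forall>y\<in>(S - (\<Union>n. A n)) \<inter> T. norm (f y - f x) \<le> B * norm (y - x))"
      if "x \<in> S - (\<Union>n. A n)" for x
      using lip that by (intro exI[of _ UNIV] exI[of _ 1]) (auto simp: dist_norm)
  qed
  then have N: "N \<in> null_sets lebesgue" by (simp add: negligible_iff_null_sets)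
  have sets: "A n \<in> sets lebesgue" "B n \<in> sets lebesgue" for n by (auto simp: A_def B_def)
  have "f ` S \<subseteq> N \<union> (\<Union>n. B n)" using fAB unfolding N_def by blast
  then have "emeasure lebesgue (f ` S) \<le> emeasure lebesgue (N \<union> (\<Union>n. B n))"
    using N sets by (intro emeasure_mono) auto
  also have "\<dots> \<le> emeasure lebesgue N + emeasure lebesgue (\<Union>n. B n)"
    using N sets by (intro emeasure_subadditive) auto
  also have "\<dots> = emeasure lebesgue (\<Union>n. B n)" using N by auto
  also have "\<dots> \<le> (\<Sum>n. emeasure lebesgue (B n))"
    using sets by (intro emeasure_subadditive_countably) auto
  also have "\<dots> = emeasure lebesgue (\<Union>n. A n)"
    unfolding AB using sets dA by (intro suminf_emeasure) auto
  also have "\<dots> \<le> emeasure lebesgue S"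
    using S c'(3) by (intro emeasure_mono) (auto simp: A_def split: if_splits)
  finally show ?thesis .
qed

text \<open>
  For outer normals \<open>n\<close>, \<open>m\<close> of a convex set at \<open>p\<close>, \<open>q\<close>, monotonicity of the normal cone says
  that \<open>(p - q) \<bullet> (n - m) \<ge> 0\<close>. Hence the difference of two points on the normal rays makes an acute
  angle with \<open>n - m\<close>, and moving both points outwards by \<open>\<delta>\<close> cannot bring them closer.
\<close>

lemma dist_expand_along_normals:
  fixes p q m n :: "'a::real_inner"
  assumes "norm n = 1" "norm m = 1" "n \<bullet> (q - p) \<le> 0" "m \<bullet> (p - q) \<le> 0" "s \<ge> 0" "t \<ge> 0" "\<delta> \<ge> 0"
  shows "dist (p + s *\<^sub>R n) (q + t *\<^sub>R m) \<le> dist (p + (s + \<delta>) *\<^sub>R n) (q + (t + \<delta>) *\<^sub>R m)"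
proof -
  define x where "x = (p + s *\<^sub>R n) - (q + t *\<^sub>R m)"
  have nm: "n \<bullet> m \<le> 1" using norm_cauchy_schwarz[of n m] assms by simp
  have "x \<bullet> (n - m) = - (n \<bullet> (q - p)) - m \<bullet> (p - q) + (s + t) * (1 - n \<bullet> m)"
    using assms(1,2) unfolding norm_eq_1
    by (simp add: x_def inner_simps inner_commute algebra_simps)
  also have "\<dots> \<ge> 0" using assms nm by auto
  finally have "0 \<le> x \<bullet> (n - m)" .
  then have "x \<bullet> x \<le> (x + \<delta> *\<^sub>R (n - m)) \<bullet> (x + \<delta> *\<^sub>R (n - m))"
    using assms(7) by (simp add: inner_add_left inner_add_right inner_commute)
  then have "norm x \<le> norm (x + \<delta> *\<^sub>R (n - m))" by (simp add: norm_le)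
  then show ?thesis by (simp add: x_def dist_norm algebra_simps)
qed

section \<open>The isodiametric inequality\<close>

text \<open>
  The Brunn-Minkowski inequality for \<open>A\<close> and \<open>- A\<close>, which have the same volume, together with
  \<open>A - A \<subseteq> cball 0 (2 R)\<close>.
\<close>

theorem isodiametric_inequality:
  fixes A :: "'a::euclidean_space set"
  assumes A: "open A" "bounded A" "A \<noteq> {}"
    and diam: "\<And>x y. x \<in> A \<Longrightarrow> y \<in> A \<Longrightarrow> dist x y \<le> 2 * R"
  shows "root DIM('a) (measure lebesgue A) \<le> R * root DIM('a) (unit_ball_vol DIM('a))"
proof -
  have R: "R \<ge> 0" using A(3) diam by (metis all_not_in_conv dist_self mult_less_0_iff not_le zero_less_numeral order_less_le_trans)
  have mA: "measure lebesgue (uminus ` A) = measure lebesgue A"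
    using measure_lebesgue_affine[of "-1" 0 A] by simp
  have ob: "open (uminus ` A)" "bounded (uminus ` A)" "uminus ` A \<noteq> {}"
    using A by (auto simp: open_negations)
  have sub: "A + uminus ` A \<subseteq> cball 0 (2 * R)"
    using diam by (auto simp: set_plus_def dist_norm)
  have "2 * root DIM('a) (measure lebesgue A) \<le> root DIM('a) (measure lebesgue (A + uminus ` A))"
    using brunn_minkowski_open[OF A ob] by (simp add: mA)
  also have "\<dots> \<le> root DIM('a) (measure lebesgue (cball (0::'a) (2 * R)))"
    by (intro real_root_le_mono measure_mono_fmeasurable[OF sub] lmeasurable_cball fmeasurableD
        lmeasurable_open open_set_plus bounded_set_plus A ob) auto
  also have "\<dots> = 2 * R * root DIM('a) (unit_ball_vol DIM('a))"
    using R by (simp add: content_cball real_root_mult real_root_power_cancel)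
  finally show ?thesis by simp
qed

section \<open>Volumes of parallel bodies\<close>

lemma has_real_derivative_sandwich:
  fixes l f q :: "real \<Rightarrow> real"
  assumes l: "(l has_real_derivative D) (at x)" and q: "(q has_real_derivative D) (at x)"
    and d: "0 < d" and le: "\<And>y. \<bar>y - x\<bar> < d \<Longrightarrow> l y \<le> f y \<and> f y \<le> q y"
    and eq: "l x = f x" "q x = f x"
  shows "(f has_real_derivative D) (at x)"
proof -
  let ?Q = "\<lambda>h y. (h y - h x) / (y - x)"
  have lim: "(?Q l \<longlongrightarrow> D) (at x)" "(?Q q \<longlongrightarrow> D) (at x)"
    using l q by (simp_all add: has_field_derivative_iff)
  have ev: "eventually (\<lambda>y. \<bar>y - x\<bar> < d \<and> y \<noteq> x) (at x)"
    using d by (auto simp: eventually_at dist_real_def)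
  have "((\<lambda>y. ?Q f y - D) \<longlongrightarrow> 0) (at x)"
  proof (rule Lim_null_comparison)
    show "((\<lambda>y. \<bar>?Q l y - D\<bar> + \<bar>?Q q y - D\<bar>) \<longlongrightarrow> 0) (at x)"
      using tendsto_add[OF tendsto_rabs_zero[OF LIM_zero[OF lim(1)]] tendsto_rabs_zero[OF LIM_zero[OF lim(2)]]]
      by simp
    show "eventually (\<lambda>y. norm (?Q f y - D) \<le> \<bar>?Q l y - D\<bar> + \<bar>?Q q y - D\<bar>) (at x)"
      using ev
    proof eventually_elim
      case (elim y)
      have "l y - l x \<le> f y - f x" "f y - f x \<le> q y - q x" using le[of y] elim eq by auto
      then have "?Q l y \<le> ?Q f y \<and> ?Q f y \<le> ?Q q y \<or> ?Q q y \<le> ?Q f y \<and> ?Q f y \<le> ?Q l y"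
        using divide_right_mono divide_right_mono_neg by (metis linear diff_ge_0_iff_ge diff_le_0_iff_le)
      then show ?case by (auto simp: abs_if)
    qed
  qed
  then show ?thesis by (simp add: has_field_derivative_iff LIM_zero_iff)
qed

text \<open>
  Open balls make the parallel sets open, hence directly accessible to the Brunn-Minkowski
  inequality. Closed balls yield the same volume for \<open>t > 0\<close>, as shown below.
\<close>

definition parallel_volume :: "'a::euclidean_space set \<Rightarrow> real \<Rightarrow> real" where
  "parallel_volume K t = measure lebesgue (K + ball 0 t)"

context
  fixes K :: "'a::euclidean_space set"
  assumes K: "compact K" "convex K" "K \<noteq> {}"
begin

lemma closed_K: "closed K" using K(1) by (rule compact_imp_closed)

lemma set_plus_ball_eq: "K + ball 0 t = {x. dist x (closest_point K x) < t}"
proof (intro set_eqI iffI CollectI)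
  fix x assume "x \<in> K + ball 0 t"
  then obtain a b where "a \<in> K" "norm b < t" "x = a + b" by (auto simp: set_plus_def)
  then show "dist x (closest_point K x) < t"
    using closest_point_le[OF closed_K, of a x] by (simp add: dist_norm)
next
  fix x assume "x \<in> {x. dist x (closest_point K x) < t}"
  then have "x - closest_point K x \<in> ball 0 t" by (simp add: dist_norm norm_minus_commute)
  from set_plus_intro[OF closest_point_in_set[OF closed_K K(3), of x] this]
  show "x \<in> K + ball 0 t" by simp
qed

lemma set_plus_cball_eq: "K + cball 0 t = {x. dist x (closest_point K x) \<le> t}"
proof (intro set_eqI iffI CollectI)
  fix x assume "x \<in> K + cball 0 t"
  then obtain a b where "a \<in> K" "norm b \<le> t" "x = a + b" by (auto simp: set_plus_def)
  then show "dist x (closest_point K x) \<le> t"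
    using closest_point_le[OF closed_K, of a x] by (simp add: dist_norm)
next
  fix x assume "x \<in> {x. dist x (closest_point K x) \<le> t}"
  then have "x - closest_point K x \<in> cball 0 t" by (simp add: dist_norm norm_minus_commute)
  from set_plus_intro[OF closest_point_in_set[OF closed_K K(3), of x] this]
  show "x \<in> K + cball 0 t" by simp
qed

lemma open_parallel: "open (K + ball 0 t)" "bounded (K + ball 0 t)"
  using open_set_plus[OF open_ball, of 0 t K] bounded_set_plus[OF compact_imp_bounded[OF K(1)] bounded_ball]
  by (simp_all add: add.commute)

lemma lmeasurable_parallel: "K + ball 0 t \<in> lmeasurable"
  using open_parallel by (intro lmeasurable_open)

lemma parallel_nonempty:
  assumes "t > 0" shows "K + ball 0 t \<noteq> {}"
proof -
  obtain k where "k \<in> K" using K(3) by blast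
  with assms have "k + 0 \<in> K + ball 0 t" by (intro set_plus_intro) auto
  then show ?thesis by blast
qed

text \<open>
  The parallel surface is part of the frontier of a convex set.
\<close>

lemma negligible_parallel_surface:
  assumes "t > 0"
  shows "negligible {x. dist x (closest_point K x) = t}"
proof (rule negligible_subset)
  show "negligible (frontier (K + ball 0 t))"
    using K by (intro negligible_convex_frontier convex_set_plus) auto
  have "K + cball 0 t = closure K + closure (ball 0 t)" using assms closed_K by simp
  also have "\<dots> \<subseteq> closure (K + ball 0 t)" by (rule closure_sum)
  finally show "{x. dist x (closest_point K x) = t} \<subseteq> frontier (K + ball 0 t)"
    unfolding frontier_def interior_open[OF open_parallel(1)]
    by (auto simp: set_plus_ball_eq set_plus_cball_eq)
qed

lemma measure_parallel_cball:
  assumes "t > 0"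
  shows "measure lebesgue (K + cball 0 t) = parallel_volume K t"
  unfolding parallel_volume_def
proof (rule measure_negligible_symdiff[OF lmeasurable_parallel])
  show "negligible (K + ball 0 t - (K + cball 0 t) \<union> (K + cball 0 t - (K + ball 0 t)))"
    by (rule negligible_subset[OF negligible_parallel_surface[OF assms]])
      (auto simp: set_plus_ball_eq set_plus_cball_eq)
qed

definition shell :: "real \<Rightarrow> real \<Rightarrow> 'a set" where
  "shell a b = {x. a < dist x (closest_point K x) \<and> dist x (closest_point K x) < b}"

lemma open_shell: "open (shell a b)"
proof -
  have "continuous_on UNIV (\<lambda>x. dist x (closest_point K x))"
    by (intro continuous_intros continuous_on_closest_point K closed_K)
  then show ?thesis
    unfolding shell_def by (intro open_Collect_conj open_Collect_less continuous_on_const)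
qed

lemma lmeasurable_shell: "shell a b \<in> lmeasurable"
  by (rule lmeasurable_open[OF bounded_subset[OF open_parallel(2)[of b]] open_shell])
    (auto simp: shell_def set_plus_ball_eq)

lemma parallel_volume_shell:
  assumes "0 < a" "a \<le> b"
  shows "parallel_volume K b = parallel_volume K a + measure lebesgue (shell a b)"
proof -
  have "measure lebesgue (K + ball 0 b) = measure lebesgue ((K + ball 0 a) \<union> shell a b)"
    by (rule measure_negligible_symdiff[OF fmeasurable.Un[OF lmeasurable_parallel lmeasurable_shell]],
        rule negligible_subset[OF negligible_parallel_surface[OF assms(1)]])
      (use assms in \<open>auto simp: set_plus_ball_eq shell_def\<close>)
  also have "\<dots> = measure lebesgue (K + ball 0 a) + measure lebesgue (shell a b)"
    using lmeasurable_parallel[of a] lmeasurable_shell[of a b]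
    by (intro measure_Union) (auto simp: fmeasurable_def set_plus_ball_eq shell_def)
  finally show ?thesis by (simp add: parallel_volume_def)
qed

lemma closest_point_normal_ray:
  assumes "p \<in> K" "norm n = 1" "\<And>z. z \<in> K \<Longrightarrow> n \<bullet> (z - p) \<le> 0" "t \<ge> 0"
  shows "closest_point K (p + t *\<^sub>R n) = p"
proof -
  have "dist (p + t *\<^sub>R n) p \<le> dist (p + t *\<^sub>R n) z" if "z \<in> K" for z
  proof -
    have "t \<le> t - n \<bullet> (z - p)" using assms(3)[OF that] by simp
    also have "\<dots> = n \<bullet> (p + t *\<^sub>R n - z)"
      using assms(2) by (simp add: inner_simps norm_eq_1)
    also have "\<dots> \<le> norm (p + t *\<^sub>R n - z)"
      using norm_cauchy_schwarz[of n "p + t *\<^sub>R n - z"] assms(2) by simp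
    finally show ?thesis using assms by (simp add: dist_norm)
  qed
  then show ?thesis using closest_point_unique[OF K(2) closed_K assms(1)] by metis
qed

text \<open>
  The map \<open>\<psi>\<close> moves each point by \<open>\<delta>\<close> towards its closest point in \<open>K\<close>. It carries the outer shell
  onto the inner one, and it does not increase distances because its inverse is the expansion along
  outer normals.
\<close>

lemma measure_shell_mono:
  assumes "0 < a" "0 \<le> \<delta>"
  shows "measure lebesgue (shell a b) \<le> measure lebesgue (shell (a + \<delta>) (b + \<delta>))"
proof -
  define \<nu> where "\<nu> x = (x - closest_point K x) /\<^sub>R dist x (closest_point K x)" for x
  define \<psi> where "\<psi> y = y - \<delta> *\<^sub>R \<nu> y" for y
  let ?p = "closest_point K" and ?d = "\<lambda>x. dist x (closest_point K x)"
  have p: "?p x \<in> K" for x by (rule closest_point_in_set[OF closed_K K(3)])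
  have x: "x = ?p x + ?d x *\<^sub>R \<nu> x" if "?d x > 0" for x
    using that by (simp add: \<nu>_def)
  have n1: "norm (\<nu> x) = 1" if "?d x > 0" for x
    using that by (simp add: \<nu>_def dist_norm)
  have nk: "\<nu> x \<bullet> (z - ?p x) \<le> 0" if "z \<in> K" for x z
    using closest_point_dot[OF K(2) closed_K that, of x]
    by (simp add: \<nu>_def mult_nonneg_nonpos)
  have psi: "\<psi> y = ?p y + (?d y - \<delta>) *\<^sub>R \<nu> y" if "?d y > 0" for y
  proof -
    have "\<psi> y = ?p y + ?d y *\<^sub>R \<nu> y - \<delta> *\<^sub>R \<nu> y" using x[OF that] by (simp add: \<psi>_def)
    then show ?thesis by (simp add: algebra_simps)
  qed
  have img: "\<psi> ` shell (a + \<delta>) (b + \<delta>) = shell a b"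
  proof (intro equalityI subsetI)
    fix z assume "z \<in> \<psi> ` shell (a + \<delta>) (b + \<delta>)"
    then obtain y where y: "a + \<delta> < ?d y" "?d y < b + \<delta>" "z = \<psi> y" by (auto simp: shell_def)
    have pos: "?d y > 0" using y assms by linarith
    have "?p z = ?p y"
      unfolding y(3) psi[OF pos] using y assms p n1[OF pos] nk by (intro closest_point_normal_ray) auto
    then have "?d z = ?d y - \<delta>"
      using y assms n1[OF pos] unfolding y(3) by (simp add: psi[OF pos] dist_norm)
    then show "z \<in> shell a b" using y by (simp add: shell_def)
  next
    fix x' assume "x' \<in> shell a b"
    then have d: "a < ?d x'" "?d x' < b" by (auto simp: shell_def)
    have pos: "?d x' > 0" using d assms by linarith
    define y where "y = ?p x' + (?d x' + \<delta>) *\<^sub>R \<nu> x'"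
    have py: "?p y = ?p x'"
      unfolding y_def using d assms p n1[OF pos] nk by (intro closest_point_normal_ray) auto
    have dy: "?d y = ?d x' + \<delta>"
    proof -
      have "y - ?p y = (?d x' + \<delta>) *\<^sub>R \<nu> x'" unfolding py by (simp add: y_def)
      then show ?thesis unfolding dist_norm[of y] using pos assms n1[OF pos] by simp
    qed
    have ny: "\<nu> y = \<nu> x'"
    proof -
      have "\<nu> y = (1 / ?d y) *\<^sub>R (y - ?p y)" by (simp add: \<nu>_def divide_inverse)
      also have "y - ?p y = ?d y *\<^sub>R \<nu> x'" unfolding dy unfolding py by (simp add: y_def)
      finally show ?thesis using dy pos assms by simp
    qed
    have "?d y > 0" using dy pos assms by linarith
    then have "\<psi> y = ?p y + (?d y - \<delta>) *\<^sub>R \<nu> y" by (rule psi)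
    also have "\<dots> = ?p y + ?d x' *\<^sub>R \<nu> x'" by (simp only: dy ny) simp
    also have "\<dots> = x'" using x[OF pos] by (simp only: py)
    finally have "\<psi> y = x'" .
    moreover have "y \<in> shell (a + \<delta>) (b + \<delta>)" using dy d by (simp add: shell_def)
    ultimately show "x' \<in> \<psi> ` shell (a + \<delta>) (b + \<delta>)" by blast
  qed
  have "emeasure lebesgue (\<psi> ` shell (a + \<delta>) (b + \<delta>)) \<le> emeasure lebesgue (shell (a + \<delta>) (b + \<delta>))"
  proof (rule emeasure_lipschitz_image_le[OF open_shell])
    show "\<psi> ` shell (a + \<delta>) (b + \<delta>) \<in> sets lebesgue" unfolding img using lmeasurable_shell by blast
    fix y z assume yz: "y \<in> shell (a + \<delta>) (b + \<delta>)" "z \<in> shell (a + \<delta>) (b + \<delta>)"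
    then have y: "a + \<delta> < ?d y" "?d y > 0" and z: "a + \<delta> < ?d z" "?d z > 0"
      using assms by (auto simp: shell_def)
    have "dist (\<psi> y) (\<psi> z) \<le> dist (?p y + (?d y - \<delta> + \<delta>) *\<^sub>R \<nu> y) (?p z + (?d z - \<delta> + \<delta>) *\<^sub>R \<nu> z)"
      unfolding psi[OF y(2)] psi[OF z(2)]
      by (rule dist_expand_along_normals) (use y z assms n1 nk p in auto)
    then show "dist (\<psi> y) (\<psi> z) \<le> dist y z"
      using x[OF y(2)] x[OF z(2)] by simp
  qed
  then show ?thesis
    unfolding img using lmeasurable_shell by (simp add: emeasure_eq_measure2)
qed

lemma parallel_volume_second_difference:
  assumes "0 < h" "h < t"
  shows "2 * parallel_volume K t \<le> parallel_volume K (t + h) + parallel_volume K (t - h)"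
  using parallel_volume_shell[of "t - h" t] parallel_volume_shell[of t "t + h"]
    measure_shell_mono[of "t - h" h t] assms by simp

text \<open>
  Concavity of the \<open>n\<close>-th root of the parallel volume: the Brunn-Minkowski inequality for the scaled
  parallel bodies \<open>(1 - u) (K + s B)\<close> and \<open>u (K + t B)\<close>.
\<close>

lemma root_parallel_volume_superadditive:
  assumes "0 < s" "0 < t" "0 \<le> u" "u \<le> 1"
  shows "(1 - u) * root DIM('a) (parallel_volume K s) + u * root DIM('a) (parallel_volume K t)
     \<le> root DIM('a) (parallel_volume K ((1 - u) * s + u * t))"
proof (cases "u = 0 \<or> u = 1")
  case False
  then have u: "0 < u" "u < 1" using assms by auto
  let ?S = "\<lambda>c A. (\<lambda>x. c *\<^sub>R x) ` (A :: 'a set)"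
  have sc: "root DIM('a) (measure lebesgue (?S c A)) = c * root DIM('a) (measure lebesgue A)" if "c > 0" for c A
    using measure_lebesgue_affine[of c 0 A] that by (simp add: real_root_mult real_root_power_cancel)
  have ob: "open (?S c (K + ball 0 r))" "bounded (?S c (K + ball 0 r))" if "c > 0" for c r
    using open_parallel that by (auto intro!: open_scaling bounded_scaling)
  have ne: "?S c (K + ball 0 r) \<noteq> {}" if "r > 0" for c r
    using parallel_nonempty[OF that] by blast
  have sub: "?S (1 - u) (K + ball 0 s) + ?S u (K + ball 0 t) \<subseteq> K + ball 0 ((1 - u) * s + u * t)"
  proof
    fix z assume "z \<in> ?S (1 - u) (K + ball 0 s) + ?S u (K + ball 0 t)"
    then obtain a b a' b' where z: "z = (1 - u) *\<^sub>R (a + b) + u *\<^sub>R (a' + b')"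
      "a \<in> K" "a' \<in> K" "norm b < s" "norm b' < t"
      by (auto simp: set_plus_def)
    have "(1 - u) *\<^sub>R a + u *\<^sub>R a' \<in> K" using K(2) z u by (auto simp: convex_alt)
    moreover have "norm ((1 - u) *\<^sub>R b + u *\<^sub>R b') < (1 - u) * s + u * t"
    proof -
      have "norm ((1 - u) *\<^sub>R b + u *\<^sub>R b') \<le> (1 - u) * norm b + u * norm b'"
        using norm_triangle_ineq[of "(1 - u) *\<^sub>R b" "u *\<^sub>R b'"] u by simp
      also have "\<dots> < (1 - u) * s + u * t"
        using u z by (intro add_strict_mono mult_strict_left_mono) auto
      finally show ?thesis .
    qed
    moreover have "z = ((1 - u) *\<^sub>R a + u *\<^sub>R a') + ((1 - u) *\<^sub>R b + u *\<^sub>R b')"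
      by (simp add: z algebra_simps)
    ultimately show "z \<in> K + ball 0 ((1 - u) * s + u * t)"
      by (simp only: set_plus_intro mem_ball dist_0_norm)
  qed
  have "(1 - u) * root DIM('a) (parallel_volume K s) + u * root DIM('a) (parallel_volume K t)
     \<le> root DIM('a) (measure lebesgue (?S (1 - u) (K + ball 0 s) + ?S u (K + ball 0 t)))"
    using brunn_minkowski_open[OF ob(1,2)[of "1 - u" s] ne ob(1,2)[of u t] ne] u assms
    by (simp add: sc parallel_volume_def)
  also have "\<dots> \<le> root DIM('a) (parallel_volume K ((1 - u) * s + u * t))"
    unfolding parallel_volume_def using u
    by (intro real_root_le_mono measure_mono_fmeasurable[OF sub] lmeasurable_parallel fmeasurableD
        lmeasurable_open open_set_plus bounded_set_plus ob) auto
  finally show ?thesis .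
qed auto

lemma root_parallel_volume_growth:
  assumes "0 < s" "s < t"
  shows "root DIM('a) (parallel_volume K s) + (t - s) * root DIM('a) (unit_ball_vol DIM('a))
     \<le> root DIM('a) (parallel_volume K t)"
proof -
  have ne: "K + ball 0 s \<noteq> {}" "ball (0::'a) (t - s) \<noteq> {}"
    using parallel_nonempty assms by auto
  have sub: "K + ball 0 s + ball 0 (t - s) \<subseteq> K + ball 0 t"
  proof -
    have "ball (0::'a) s + ball 0 (t - s) \<subseteq> ball 0 t"
      by (auto simp: set_plus_def intro!: norm_triangle_lt)
    then show ?thesis by (simp add: add.assoc set_plus_mono2)
  qed
  have "root DIM('a) (measure lebesgue (ball (0::'a) (t - s))) = (t - s) * root DIM('a) (unit_ball_vol DIM('a))"
    using assms by (simp add: content_ball real_root_mult real_root_power_cancel)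
  then have "root DIM('a) (parallel_volume K s) + (t - s) * root DIM('a) (unit_ball_vol DIM('a))
     \<le> root DIM('a) (measure lebesgue (K + ball 0 s + ball 0 (t - s)))"
    using brunn_minkowski_open[OF open_parallel(1,2)[of s] ne(1) open_ball bounded_ball ne(2)]
    by (simp add: parallel_volume_def)
  also have "\<dots> \<le> root DIM('a) (parallel_volume K t)"
    unfolding parallel_volume_def
    by (intro real_root_le_mono measure_mono_fmeasurable[OF sub] lmeasurable_parallel fmeasurableD
        lmeasurable_open open_set_plus bounded_set_plus open_parallel bounded_ball) auto
  finally show ?thesis .
qed

text \<open>
  With \<open>g\<close> the \<open>n\<close>-th root of the volume, \<open>g t0 + b (t - t0)\<close> is a line supporting the concave function
  \<open>g\<close> from above, and its \<open>n\<close>-th power \<open>q\<close> bounds the volume from above. Reflecting \<open>q\<close> at its value at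
  \<open>t0\<close> gives a lower bound, by the second difference inequality. The two bounds touch at \<open>t0\<close> with
  equal derivatives.
\<close>

lemma has_real_derivative_parallel_volume:
  assumes t0: "0 < t0"
  obtains b where "root DIM('a) (unit_ball_vol DIM('a)) \<le> b"
    "(parallel_volume K has_real_derivative
        DIM('a) * root DIM('a) (parallel_volume K t0) ^ (DIM('a) - 1) * b) (at t0)"
proof -
  define n where "n = DIM('a)"
  have n: "n > 0" by (simp add: n_def)
  define g where "g t = root n (parallel_volume K t)" for t
  have Vg: "parallel_volume K t = g t ^ n" and g0: "g t \<ge> 0" for t
    using n by (simp_all add: g_def parallel_volume_def)
  have "convex_on {0<..} (\<lambda>t. - g t)"
  proof (rule convex_onI)
    fix u s t :: real assume "0 < u" "u < 1" "s \<in> {0<..}" "t \<in> {0<..}"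
    then show "- g ((1 - u) *\<^sub>R s + u *\<^sub>R t) \<le> (1 - u) * - g s + u * - g t"
      using root_parallel_volume_superadditive[of s t u] by (simp add: g_def n_def)
  qed simp
  moreover have "t0 \<in> interior {0<..}" using t0 by (simp add: interior_open)
  ultimately obtain m where m: "- g t \<ge> - g t0 + m * (t - t0)" if "t > 0" for t
    using convex_le_Inf_differential[of "{0<..}" "\<lambda>t. - g t" t0] by (metis greaterThan_iff)
  define b where "b = - m"
  have sup: "g t \<le> g t0 + b * (t - t0)" if "t > 0" for t using m[OF that] by (simp add: b_def)
  have "g t0 + 1 * root n (unit_ball_vol n) \<le> g (t0 + 1)"
    using root_parallel_volume_growth[of t0 "t0 + 1"] t0 by (simp add: g_def n_def)
  with sup[of "t0 + 1"] t0 have b: "root n (unit_ball_vol n) \<le> b" by simp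
  define q where "q t = (g t0 + b * (t - t0)) ^ n" for t
  have up: "parallel_volume K t \<le> q t" if "t > 0" for t
    unfolding Vg q_def using sup[OF that] g0 by (intro power_mono) auto
  have lo: "2 * q t0 - q (2 * t0 - t) \<le> parallel_volume K t" if "\<bar>t - t0\<bar> < t0" for t
  proof -
    have "2 * parallel_volume K t0 \<le> parallel_volume K t + parallel_volume K (2 * t0 - t)"
    proof (cases t t0 rule: linorder_cases)
      case less
      then show ?thesis using parallel_volume_second_difference[of "t0 - t" t0] that by (simp add: algebra_simps)
    next
      case greater
      then show ?thesis using parallel_volume_second_difference[of "t - t0" t0] that by (simp add: algebra_simps)
    qed simp
    moreover have "parallel_volume K (2 * t0 - t) \<le> q (2 * t0 - t)"
      using that by (intro up) linarith
    moreover have "q t0 = parallel_volume K t0" by (simp add: q_def Vg)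
    ultimately show ?thesis by linarith
  qed
  have dq: "(q has_real_derivative n * g t0 ^ (n - 1) * b) (at t0)"
    unfolding q_def by (auto intro!: derivative_eq_intros)
  have "((\<lambda>t. 2 * q t0 - q (2 * t0 - t)) has_real_derivative n * g t0 ^ (n - 1) * b) (at t0)"
    unfolding q_def by (auto intro!: derivative_eq_intros)
  then have "(parallel_volume K has_real_derivative n * g t0 ^ (n - 1) * b) (at t0)"
  proof (rule has_real_derivative_sandwich[OF _ dq t0])
    fix t assume t: "\<bar>t - t0\<bar> < t0"
    then have "t > 0" by linarith
    then show "2 * q t0 - q (2 * t0 - t) \<le> parallel_volume K t \<and> parallel_volume K t \<le> q t"
      using lo[OF t] up by blast
  next
    show "2 * q t0 - q (2 * t0 - t0) = parallel_volume K t0" "q t0 = parallel_volume K t0"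
      by (simp_all add: q_def Vg)
  qed
  then show thesis using that[of b] b by (simp add: g_def n_def)
qed

text \<open>
  The numerator of the derivative is a positive multiple of \<open>R b - g\<close>. It is nonnegative because
  \<open>g \<le> R \<omega>\<^sup>1\<^sup>/\<^sup>n\<close> by the isodiametric inequality and \<open>\<omega>\<^sup>1\<^sup>/\<^sup>n \<le> b\<close>.
\<close>

lemma parallel_isoperimetric_ratio_derivative:
  assumes t0: "0 < t0" and R: "0 < R"
    and diam: "\<And>x y. x \<in> K + ball 0 t0 \<Longrightarrow> y \<in> K + ball 0 t0 \<Longrightarrow> dist x y \<le> 2 * R"
  obtains D where "D \<ge> 0"
    "((\<lambda>t. parallel_volume K t / (unit_ball_vol DIM('a) * (R + (t - t0)) ^ DIM('a)))
       has_real_derivative D) (at t0)"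
proof -
  define n where "n = DIM('a)"
  have n: "n > 0" by (simp add: n_def)
  define \<omega> where "\<omega> = unit_ball_vol n"
  have \<omega>: "\<omega> > 0" by (simp add: \<omega>_def)
  define g where "g = root n (parallel_volume K t0)"
  have g0: "g \<ge> 0" and Vg: "parallel_volume K t0 = g ^ n"
    using n by (simp_all add: g_def parallel_volume_def)
  obtain b where b: "root n \<omega> \<le> b" and d: "(parallel_volume K has_real_derivative n * g ^ (n - 1) * b) (at t0)"
    using has_real_derivative_parallel_volume[OF t0] unfolding n_def \<omega>_def g_def by blast
  have "g \<le> R * root n \<omega>"
    unfolding g_def parallel_volume_def n_def \<omega>_def
    by (rule isodiametric_inequality[OF open_parallel parallel_nonempty[OF t0] diam])
  also have "\<dots> \<le> R * b" using b R by simp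
  finally have gb: "g \<le> R * b" .
  let ?D = "(n * g ^ (n - 1) * b * (\<omega> * R ^ n) - g ^ n * (\<omega> * (n * R ^ (n - 1)))) / ((\<omega> * R ^ n) * (\<omega> * R ^ n))"
  have "((\<lambda>t. parallel_volume K t / (\<omega> * (R + (t - t0)) ^ n)) has_real_derivative ?D) (at t0)"
    using R \<omega> by (auto intro!: derivative_eq_intros d simp: Vg)
  moreover have "?D \<ge> 0"
  proof -
    have e: "g ^ n = g * g ^ (n - 1)" "R ^ n = R * R ^ (n - 1)"
      using n by (simp_all flip: power_Suc)
    have "n * g ^ (n - 1) * b * (\<omega> * R ^ n) - g ^ n * (\<omega> * (n * R ^ (n - 1)))
        = n * g ^ (n - 1) * \<omega> * R ^ (n - 1) * (R * b - g)"
      unfolding e by (simp add: algebra_simps)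
    also have "\<dots> \<ge> 0" using gb g0 R \<omega> by (intro mult_nonneg_nonneg) auto
    finally show ?thesis using \<omega> R by (intro divide_nonneg_nonneg) auto
  qed
  ultimately show thesis using that by (simp add: n_def \<omega>_def)
qed

end

section \<open>Balls touching a smooth convex surface from the inside\<close>

text \<open>
  The Hessian is bounded near \<open>p0\<close>, so the gradient is Lipschitz there. The mean value inequality for
  \<open>x \<mapsto> f x - G p \<bullet> x\<close> on the segment from \<open>p\<close> to \<open>y\<close> then yields the quadratic remainder with
  constants that do not depend on \<open>p\<close>.
\<close>

lemma C2_quadratic_remainder:
  fixes f :: "real^3 \<Rightarrow> real" and G :: "real^3 \<Rightarrow> real^3"
  assumes C2: "C2_with_gradient_on f G U" and U: "open U" "p0 \<in> U" and G0: "G p0 \<noteq> 0"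
  obtains \<rho> M m where "\<rho> > 0" "M > 0" "m > 0" "cball p0 \<rho> \<subseteq> U"
    "\<And>p. p \<in> cball p0 \<rho> \<Longrightarrow> m \<le> norm (G p)"
    "\<And>p y. p \<in> cball p0 \<rho> \<Longrightarrow> y \<in> cball p0 \<rho> \<Longrightarrow> \<bar>f y - f p - G p \<bullet> (y - p)\<bar> \<le> M * (norm (y - p))\<^sup>2"
proof -
  obtain H :: "real^3 \<Rightarrow> (real^3) \<Rightarrow>\<^sub>L (real^3)" where
    f: "\<And>x. x \<in> U \<Longrightarrow> (f has_derivative (\<lambda>h. G x \<bullet> h)) (at x)" and
    G: "\<And>x. x \<in> U \<Longrightarrow> (G has_derivative blinfun_apply (H x)) (at x)" and
    H: "continuous_on U H"
    using C2 unfolding C2_with_gradient_on_def by blast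
  define m where "m = norm (G p0) / 2"
  have m: "m > 0" "m < norm (G p0)" using G0 by (auto simp: m_def)
  have "isCont (\<lambda>x. norm (G x)) p0"
    using has_derivative_continuous[OF G[OF U(2)]] by (intro continuous_norm)
  then have "eventually (\<lambda>x. norm (G x) > m) (nhds p0)"
    unfolding eventually_nhds_conv_at isCont_def using m(2) by (auto dest: order_tendstoD(1))
  then obtain d where d: "d > 0" "\<And>x. dist x p0 < d \<Longrightarrow> norm (G x) > m"
    by (auto simp: eventually_nhds_metric)
  obtain e where e: "e > 0" "cball p0 e \<subseteq> U" using U open_contains_cball by blast
  define \<rho> where "\<rho> = min e (d / 2)"
  have \<rho>: "\<rho> > 0" using e d by (simp add: \<rho>_def)
  have sub: "cball p0 \<rho> \<subseteq> U"
  proof -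
    have "cball p0 \<rho> \<subseteq> cball p0 e" by (simp add: \<rho>_def subset_cball)
    with e(2) show ?thesis by blast
  qed
  have "compact (H ` cball p0 \<rho>)"
    using H sub by (intro compact_continuous_image continuous_on_subset[OF H]) auto
  then obtain M where M: "M > 0" "\<And>x. x \<in> cball p0 \<rho> \<Longrightarrow> norm (H x) \<le> M"
    using compact_imp_bounded bounded_pos by (metis imageI)
  have GL: "norm (G x - G p) \<le> M * norm (x - p)" if "x \<in> cball p0 \<rho>" "p \<in> cball p0 \<rho>" for x p
    by (rule differentiable_bound[OF convex_cball _ _ that])
      (use sub M(2) in \<open>auto simp: norm_blinfun.rep_eq[symmetric] intro!: has_derivative_at_withinI[OF G]\<close>)
  have rem: "\<bar>f y - f p - G p \<bullet> (y - p)\<bar> \<le> M * (norm (y - p))\<^sup>2"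
    if py: "p \<in> cball p0 \<rho>" "y \<in> cball p0 \<rho>" for p y
  proof -
    have seg: "closed_segment p y \<subseteq> cball p0 \<rho>"
      using py by (intro closed_segment_subset convex_cball)
    have "norm ((f y - G p \<bullet> y) - (f p - G p \<bullet> p)) \<le> (M * norm (y - p)) * norm (y - p)"
    proof (rule differentiable_bound[OF convex_closed_segment[of p y]])
      fix x assume x: "x \<in> closed_segment p y"
      then have xc: "x \<in> cball p0 \<rho>" using seg by blast
      show "((\<lambda>x. f x - G p \<bullet> x) has_derivative (\<lambda>h. G x \<bullet> h - G p \<bullet> h)) (at x within closed_segment p y)"
        by (rule has_derivative_at_withinI[OF has_derivative_diff[OF f has_derivative_inner_right[OF has_derivative_ident]]])
          (use xc sub in blast)
      have "norm (G x - G p) \<le> M * norm (x - p)" using GL xc py by blast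
      also have "\<dots> \<le> M * norm (y - p)"
        using M(1) dist_in_closed_segment[OF x] by (auto simp: dist_norm norm_minus_commute)
      finally have GM: "norm (G x - G p) \<le> M * norm (y - p)" .
      have "norm (G x \<bullet> h - G p \<bullet> h) \<le> M * norm (y - p) * norm h" for h
      proof -
        have "\<bar>(G x - G p) \<bullet> h\<bar> \<le> norm (G x - G p) * norm h" by (rule Cauchy_Schwarz_ineq2)
        also have "\<dots> \<le> M * norm (y - p) * norm h" using GM by (rule mult_right_mono) simp
        finally show ?thesis by (simp add: inner_diff_left)
      qed
      then show "onorm (\<lambda>h. G x \<bullet> h - G p \<bullet> h) \<le> M * norm (y - p)"
        by (rule onorm_le)
    qed auto
    then show ?thesis by (simp add: inner_diff_right power2_eq_square algebra_simps)
  qed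
  show thesis
    by (rule that[of \<rho> M m]) (use \<rho> M m sub rem d in \<open>auto simp: \<rho>_def dist_commute less_imp_le\<close>)
qed

text \<open>
  Points \<open>x\<close> of the surface near \<open>p\<close> satisfy \<open>\<bar>G p \<bullet> (x - p)\<bar> \<le> M \<bar>x - p\<bar>\<^sup>2\<close>. A point of an \<open>\<epsilon>\<close>-ball
  tangent at \<open>p\<close> satisfies \<open>\<bar>x - p\<bar>\<^sup>2 < 2 \<epsilon> \<nu> \<bullet> (x - p)\<close> with \<open>\<nu> = \<plusminus> G p / \<bar>G p\<bar>\<close>. For \<open>2 \<epsilon> M \<le> \<bar>G p\<bar>\<close>
  the two conditions exclude each other.
\<close>

lemma C2_tangent_balls:
  fixes S :: "(real^3) set"
  assumes "C2_smooth_surface S" "p0 \<in> S"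
  obtains \<delta> \<epsilon> where "\<delta> > 0" "\<epsilon> > 0"
    "\<And>p. p \<in> S \<Longrightarrow> dist p p0 < \<delta> \<Longrightarrow>
       \<exists>\<nu>. norm \<nu> = 1 \<and> ball (p + \<epsilon> *\<^sub>R \<nu>) \<epsilon> \<inter> S = {} \<and> ball (p - \<epsilon> *\<^sub>R \<nu>) \<epsilon> \<inter> S = {}"
proof -
  obtain U f G where U: "open U" "p0 \<in> U" and C2: "C2_with_gradient_on f G U"
    and SU: "S \<inter> U = {x \<in> U. f x = 0}" and G0: "\<forall>x\<in>U. G x \<noteq> 0"
    using bspec[OF assms(1)[unfolded C2_smooth_surface_def] assms(2)] by (elim exE conjE)
  obtain \<rho> M m where \<rho>: "\<rho> > 0" "M > 0" "m > 0" "cball p0 \<rho> \<subseteq> U"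
    and m: "\<And>p. p \<in> cball p0 \<rho> \<Longrightarrow> m \<le> norm (G p)"
    and rem: "\<And>p y. p \<in> cball p0 \<rho> \<Longrightarrow> y \<in> cball p0 \<rho> \<Longrightarrow>
      \<bar>f y - f p - G p \<bullet> (y - p)\<bar> \<le> M * (norm (y - p))\<^sup>2"
    using C2_quadratic_remainder[OF C2 U bspec[OF G0 U(2)]] by blast
  \<comment> \<open>For \<open>p\<close> within \<open>\<rho> / 3\<close> of \<open>p0\<close>, a tangent ball of radius \<open>\<rho> / 3\<close> stays within distance \<open>\<rho>\<close> of \<open>p0\<close>.\<close>
  define \<epsilon> where "\<epsilon> = min (\<rho> / 3) (m / (2 * M))"
  have \<epsilon>: "\<epsilon> > 0" "3 * \<epsilon> \<le> \<rho>" "2 * \<epsilon> * M \<le> m" 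
    using \<rho> by (auto simp: \<epsilon>_def min_def field_simps)
  have ball: "ball (p + \<epsilon> *\<^sub>R \<nu>) \<epsilon> \<inter> S = {}"
    if p: "p \<in> S" "dist p p0 < \<rho> / 3" and \<nu>: "\<nu> = s *\<^sub>R G p" "\<bar>s\<bar> = 1 / norm (G p)" for p \<nu> s
  proof (rule ccontr)
    assume "ball (p + \<epsilon> *\<^sub>R \<nu>) \<epsilon> \<inter> S \<noteq> {}"
    then obtain x where x: "x \<in> S" "dist (p + \<epsilon> *\<^sub>R \<nu>) x < \<epsilon>" by auto
    have pc: "p \<in> cball p0 \<rho>" using p \<rho> by (simp add: dist_commute)
    have Gp: "norm (G p) > 0" using m[OF pc] \<rho> by linarith
    have n1: "norm \<nu> = 1" using \<nu> Gp by simp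
    have "dist p0 x \<le> dist p0 p + dist p (p + \<epsilon> *\<^sub>R \<nu>) + dist (p + \<epsilon> *\<^sub>R \<nu>) x"
      using dist_triangle[of p0 x p] dist_triangle[of p x "p + \<epsilon> *\<^sub>R \<nu>"] by linarith
    also have "dist p (p + \<epsilon> *\<^sub>R \<nu>) = \<epsilon>" using n1 \<epsilon> by (simp add: dist_norm)
    finally have xc: "x \<in> cball p0 \<rho>" using p x \<epsilon> by (simp add: dist_commute)
    have "f x = 0" "f p = 0" using SU \<rho>(4) xc pc x p by blast+
    then have q: "\<bar>G p \<bullet> (x - p)\<bar> \<le> M * (norm (x - p))\<^sup>2" using rem[OF pc xc] by simp
    have "(norm (x - p - \<epsilon> *\<^sub>R \<nu>))\<^sup>2 < \<epsilon>\<^sup>2"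
      using x(2) by (intro power_strict_mono) (auto simp: dist_norm norm_minus_commute algebra_simps)
    also have "(norm (x - p - \<epsilon> *\<^sub>R \<nu>))\<^sup>2 = (norm (x - p))\<^sup>2 - 2 * \<epsilon> * (\<nu> \<bullet> (x - p)) + \<epsilon>\<^sup>2"
      using n1 unfolding power2_norm_eq_inner norm_eq_1
      by (simp add: inner_diff_left inner_diff_right inner_commute power2_eq_square algebra_simps)
    finally have "(norm (x - p))\<^sup>2 < 2 * \<epsilon> * (\<nu> \<bullet> (x - p))" by simp
    also have "\<dots> \<le> 2 * \<epsilon> * (\<bar>G p \<bullet> (x - p)\<bar> / norm (G p))"
    proof -
      have "\<nu> \<bullet> (x - p) \<le> \<bar>s\<bar> * \<bar>G p \<bullet> (x - p)\<bar>"
        unfolding \<nu>(1) by (simp flip: abs_mult)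
      then have "\<nu> \<bullet> (x - p) \<le> \<bar>G p \<bullet> (x - p)\<bar> / norm (G p)" using \<nu>(2) by simp
      then show ?thesis using \<epsilon>(1) by (intro mult_left_mono) auto
    qed
    also have "\<dots> \<le> 2 * \<epsilon> * (M * (norm (x - p))\<^sup>2 / m)"
      using \<epsilon> q m[OF pc] \<rho> by (intro mult_left_mono frac_le) auto
    also have "\<dots> = (2 * \<epsilon> * M / m) * (norm (x - p))\<^sup>2" by simp
    also have "\<dots> \<le> 1 * (norm (x - p))\<^sup>2" using \<epsilon> \<rho> by (intro mult_right_mono) auto
    finally show False by simp
  qed
  show thesis
  proof (rule that[of "\<rho> / 3" \<epsilon>])
    fix p assume p: "p \<in> S" "dist p p0 < \<rho> / 3"
    then have "p \<in> cball p0 \<rho>" using \<rho> by (simp add: dist_commute)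
    then have Gp: "norm (G p) > 0" using m \<rho> by (meson less_le_trans)
    let ?n = "(1 / norm (G p)) *\<^sub>R G p"
    show "\<exists>\<nu>. norm \<nu> = 1 \<and> ball (p + \<epsilon> *\<^sub>R \<nu>) \<epsilon> \<inter> S = {} \<and> ball (p - \<epsilon> *\<^sub>R \<nu>) \<epsilon> \<inter> S = {}"
      using ball[OF p, of ?n "1 / norm (G p)"] ball[OF p, of "- ?n" "- (1 / norm (G p))"] Gp
      by (intro exI[of _ ?n]) auto
  qed (use \<rho> \<epsilon> in auto)
qed

text \<open>
  Each ball is connected and avoids the frontier, so it lies inside \<open>K\<close> or outside \<open>K\<close>. If both lay
  outside, the quadratic bound \<open>2 \<epsilon> \<bar>\<nu> \<bullet> z\<bar> \<le> \<bar>z\<bar>\<^sup>2\<close> for \<open>p + z \<in> K\<close> could be applied to \<open>s z\<close> with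
  \<open>s \<rightarrow> 0\<close>, by convexity, and would force \<open>K\<close> into the tangent hyperplane at \<open>p\<close>.
\<close>

lemma interior_tangent_ball:
  fixes K :: "'a::euclidean_space set"
  assumes K: "closed K" "convex K" "interior K \<noteq> {}" and p: "p \<in> K"
    and \<nu>: "norm \<nu> = 1" and \<epsilon>: "\<epsilon> > 0"
    and b: "ball (p + \<epsilon> *\<^sub>R \<nu>) \<epsilon> \<inter> frontier K = {}" "ball (p - \<epsilon> *\<^sub>R \<nu>) \<epsilon> \<inter> frontier K = {}"
  obtains q where "dist p q = \<epsilon>" "cball q \<epsilon> \<subseteq> K"
proof -
  have dich: "cball q \<epsilon> \<subseteq> K" if "ball q \<epsilon> \<inter> frontier K = {}" "ball q \<epsilon> \<inter> K \<noteq> {}" for q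
  proof -
    have "ball q \<epsilon> \<subseteq> K" using connected_Int_frontier[OF connected_ball, of q \<epsilon> K] that by blast
    then have "closure (ball q \<epsilon>) \<subseteq> K" using K(1) by (rule closure_minimal)
    then show ?thesis using \<epsilon> by simp
  qed
  have "\<exists>q. dist p q = \<epsilon> \<and> ball q \<epsilon> \<inter> frontier K = {} \<and> ball q \<epsilon> \<inter> K \<noteq> {}"
  proof (rule ccontr)
    assume no: "\<not> ?thesis"
    have "dist p (p + \<epsilon> *\<^sub>R \<nu>) = \<epsilon>" "dist p (p - \<epsilon> *\<^sub>R \<nu>) = \<epsilon>" using \<nu> \<epsilon> by (auto simp: dist_norm)
    then have out: "ball (p + \<epsilon> *\<^sub>R \<nu>) \<epsilon> \<inter> K = {}" "ball (p - \<epsilon> *\<^sub>R \<nu>) \<epsilon> \<inter> K = {}"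
      using no b by blast+
    have ineq: "2 * \<epsilon> * \<bar>\<nu> \<bullet> z\<bar> \<le> (norm z)\<^sup>2" if "p + z \<in> K" for z
    proof -
      have "\<epsilon>\<^sup>2 \<le> (norm (\<epsilon> *\<^sub>R \<nu> - z))\<^sup>2" "\<epsilon>\<^sup>2 \<le> (norm (\<epsilon> *\<^sub>R \<nu> + z))\<^sup>2"
      proof -
        have "p + z \<notin> ball (p + \<epsilon> *\<^sub>R \<nu>) \<epsilon>" "p + z \<notin> ball (p - \<epsilon> *\<^sub>R \<nu>) \<epsilon>" using out that by blast+
        then have "\<epsilon> \<le> norm (\<epsilon> *\<^sub>R \<nu> - z)" "\<epsilon> \<le> norm (- (\<epsilon> *\<^sub>R \<nu> + z))"
          by (simp_all add: dist_norm algebra_simps)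
        then have "\<epsilon> \<le> norm (\<epsilon> *\<^sub>R \<nu> - z)" "\<epsilon> \<le> norm (\<epsilon> *\<^sub>R \<nu> + z)" by (simp_all only: norm_minus_cancel)
        then show "\<epsilon>\<^sup>2 \<le> (norm (\<epsilon> *\<^sub>R \<nu> - z))\<^sup>2" "\<epsilon>\<^sup>2 \<le> (norm (\<epsilon> *\<^sub>R \<nu> + z))\<^sup>2"
          using \<epsilon> by (auto intro: power_mono)
      qed
      moreover have "\<nu> \<bullet> \<nu> = 1" using \<nu> by (simp add: norm_eq_1)
      ultimately have "2 * \<epsilon> * (\<nu> \<bullet> z) \<le> z \<bullet> z" "- (2 * \<epsilon> * (\<nu> \<bullet> z)) \<le> z \<bullet> z"
        unfolding power2_norm_eq_inner
        by (simp_all add: inner_diff_left inner_diff_right inner_add_left inner_add_right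
            inner_commute power2_eq_square algebra_simps)
      then show ?thesis by (auto simp: power2_norm_eq_inner abs_if)
    qed
    have "K \<subseteq> {y. \<nu> \<bullet> y = \<nu> \<bullet> p}"
    proof
      fix y assume y: "y \<in> K"
      define z where "z = y - p"
      have "2 * \<epsilon> * \<bar>\<nu> \<bullet> z\<bar> \<le> s * (norm z)\<^sup>2" if s: "0 < s" "s \<le> 1" for s
      proof -
        have "p + s *\<^sub>R z = (1 - s) *\<^sub>R p + s *\<^sub>R y" by (simp add: z_def algebra_simps)
        also have "\<dots> \<in> K" using K(2) p y s by (auto simp: convex_alt)
        finally have "s * (2 * \<epsilon> * \<bar>\<nu> \<bullet> z\<bar>) \<le> s * (s * (norm z)\<^sup>2)"
          using ineq[of "s *\<^sub>R z"] s by (simp add: abs_mult power_mult_distrib power2_eq_square algebra_simps)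
        then show ?thesis using s by simp
      qed
      then have ev: "eventually (\<lambda>s. 2 * \<epsilon> * \<bar>\<nu> \<bullet> z\<bar> \<le> s * (norm z)\<^sup>2) (at_right 0)"
        using eventually_at_right_real[of 0 1] by (auto elim: eventually_mono)
      have "((\<lambda>s. s * (norm z)\<^sup>2) \<longlongrightarrow> 0 * (norm z)\<^sup>2) (at_right 0)" by (intro tendsto_intros)
      then have "2 * \<epsilon> * \<bar>\<nu> \<bullet> z\<bar> \<le> 0 * (norm z)\<^sup>2"
        using ev by (rule tendsto_lowerbound) simp
      then have "\<nu> \<bullet> z = 0" using \<epsilon> by (simp add: mult_le_0_iff)
      then show "y \<in> {y. \<nu> \<bullet> y = \<nu> \<bullet> p}" by (simp add: z_def inner_diff_right)
    qed
    moreover have "\<nu> \<noteq> 0" using \<nu> by auto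
    ultimately show False
      using K(3) interior_mono[of K "{y. \<nu> \<bullet> y = \<nu> \<bullet> p}"] interior_hyperplane[of \<nu> "\<nu> \<bullet> p"] by auto
  qed
  then show thesis using dich that by blast
qed

text \<open>
  The local radii are made uniform by compactness. A tangent ball may be shrunk towards its point of
  contact without leaving \<open>K\<close>.
\<close>

lemma rolling_ball:
  fixes K :: "(real^3) set"
  assumes S: "bounds_convex_body S K" "C2_smooth_surface S"
  obtains \<epsilon> where "\<epsilon> > 0" "\<And>p. p \<in> S \<Longrightarrow> \<exists>q. dist p q = \<epsilon> \<and> cball q \<epsilon> \<subseteq> K"
proof -
  have K: "compact K" "convex K" "interior K \<noteq> {}" and SK: "S = frontier K"
    using S by (auto simp: bounds_convex_body_def)
  have cK: "closed K" using K(1) by (rule compact_imp_closed)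
  have cS: "compact S" using K(1) SK compact_frontier by blast
  have sub: "S \<subseteq> K" using cK SK by (simp add: frontier_subset_closed)
  have "\<exists>\<delta> \<epsilon>. \<delta> > 0 \<and> \<epsilon> > 0 \<and> (\<forall>p\<in>S. dist p p0 < \<delta> \<longrightarrow> (\<exists>q. dist p q = \<epsilon> \<and> cball q \<epsilon> \<subseteq> K))"
    if "p0 \<in> S" for p0
  proof -
    obtain \<delta> \<epsilon> where d: "\<delta> > 0" "\<epsilon> > 0"
      and b: "\<And>p. p \<in> S \<Longrightarrow> dist p p0 < \<delta> \<Longrightarrow>
       \<exists>\<nu>. norm \<nu> = 1 \<and> ball (p + \<epsilon> *\<^sub>R \<nu>) \<epsilon> \<inter> S = {} \<and> ball (p - \<epsilon> *\<^sub>R \<nu>) \<epsilon> \<inter> S = {}"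
      using C2_tangent_balls[OF S(2) \<open>p0 \<in> S\<close>] by blast
    have "\<exists>q. dist p q = \<epsilon> \<and> cball q \<epsilon> \<subseteq> K" if "p \<in> S" "dist p p0 < \<delta>" for p
      using b[OF that] interior_tangent_ball[OF cK K(2,3) _ _ d(2), of p] that sub unfolding SK by (metis subsetD)
    with d show ?thesis by blast
  qed
  then obtain \<delta> \<epsilon> where de: "\<And>p0. p0 \<in> S \<Longrightarrow> \<delta> p0 > 0 \<and> \<epsilon> p0 > (0::real)"
    "\<And>p0 p. p0 \<in> S \<Longrightarrow> p \<in> S \<Longrightarrow> dist p p0 < \<delta> p0 \<Longrightarrow> \<exists>q. dist p q = \<epsilon> p0 \<and> cball q (\<epsilon> p0) \<subseteq> K"
    by metis
  have "S \<subseteq> (\<Union>p0\<in>S. ball p0 (\<delta> p0))" using de(1) by force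
  then obtain F where F: "F \<subseteq> S" "finite F" "S \<subseteq> (\<Union>p0\<in>F. ball p0 (\<delta> p0))"
    using compactE_image[OF cS, of S "\<lambda>p0. ball p0 (\<delta> p0)"] by auto
  \<comment> \<open>The element 1 only guards against an empty set.\<close>
  define e where "e = Min (insert 1 (\<epsilon> ` F))"
  have e: "e > 0" using F de(1) by (auto simp: e_def Min_gr_iff)
  have "\<exists>q. dist p q = e \<and> cball q e \<subseteq> K" if p: "p \<in> S" for p
  proof -
    obtain p0 where p0: "p0 \<in> F" "dist p p0 < \<delta> p0" using F p by (force simp: dist_commute)
    then obtain q where q: "dist p q = \<epsilon> p0" "cball q (\<epsilon> p0) \<subseteq> K" using de(2) F p by blast
    have le: "e \<le> \<epsilon> p0" "\<epsilon> p0 > 0" using F p0 de(1) by (auto simp: e_def intro!: Min_le)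
    define q' where "q' = p + (e / \<epsilon> p0) *\<^sub>R (q - p)"
    have "dist p q' = e" using q(1) le e by (simp add: q'_def dist_norm norm_minus_commute)
    moreover have "cball q' e \<subseteq> cball q (\<epsilon> p0)"
    proof -
      have "q - q' = (1 - e / \<epsilon> p0) *\<^sub>R (q - p)" by (simp add: q'_def algebra_simps)
      then have "dist q q' = (1 - e / \<epsilon> p0) * \<epsilon> p0"
        using q(1) le by (simp add: dist_norm norm_minus_commute)
      then have "dist q' q + e \<le> \<epsilon> p0" using le by (simp add: algebra_simps dist_commute)
      then show ?thesis using cball_subset_cball_iff by blast
    qed
    ultimately show ?thesis using q(2) by blast
  qed
  with e show thesis using that by blast
qed

section \<open>Parallel bodies and their support functions\<close>

lemma has_support_function_frontierI:
  fixes L :: "(real^3) set"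
  assumes "compact L"
    and le: "\<And>u x. norm u = 1 \<Longrightarrow> x \<in> L \<Longrightarrow> x \<bullet> u \<le> r u"
    and att: "\<And>u. norm u = 1 \<Longrightarrow> \<exists>x\<in>L. x \<bullet> u = r u"
  shows "has_support_function (frontier L) r"
  unfolding has_support_function_def support_function_def
proof
  fix u :: "real^3" assume "u \<in> sphere 0 1"
  then have u: "norm u = 1" by simp
  obtain x where x: "x \<in> L" "x \<bullet> u = r u" using att[OF u] by blast
  have cL: "closed L" using assms(1) by (rule compact_imp_closed)
  have "x \<notin> interior L"
  proof
    assume "x \<in> interior L"
    then obtain d where d: "d > 0" "cball x d \<subseteq> L" by (auto simp: mem_interior_cball)
    then have "x + d *\<^sub>R u \<in> L" using u by (auto simp: dist_norm)
    from le[OF u this] x d u show False by (simp add: inner_add_left norm_eq_1)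
  qed
  then have "x \<in> frontier L" using x cL by (simp add: frontier_def closure_closed)
  moreover have "y \<bullet> u \<le> r u" if "y \<in> frontier L" for y
    using le[OF u] that frontier_subset_closed[OF cL] by blast
  ultimately show "(SUP x\<in>frontier L. x \<bullet> u) = r u"
    using x(2) by (intro cSup_eq_maximum) (auto intro: rev_image_eqI)
qed

lemma support_function_attained:
  assumes "bounds_convex_body S K" "has_support_function S r" "norm u = 1"
  obtains p where "p \<in> S" "p \<bullet> u = r u"
proof -
  have K: "compact K" "interior K \<noteq> {}" and SK: "S = frontier K"
    using assms by (auto simp: bounds_convex_body_def)
  have "K \<noteq> {}" "K \<noteq> UNIV" using K compact_imp_bounded not_bounded_UNIV by auto
  then have "S \<noteq> {}" "compact S" using SK K frontier_eq_empty compact_frontier by auto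
  then obtain p where p: "p \<in> S" "\<And>x. x \<in> S \<Longrightarrow> x \<bullet> u \<le> p \<bullet> u"
    using continuous_attains_sup[of S "\<lambda>x. x \<bullet> u"] continuous_on_inner[of S "\<lambda>x. x" "\<lambda>x. u"] by auto
  then have "(SUP x\<in>S. x \<bullet> u) = p \<bullet> u" by (intro cSup_eq_maximum) auto
  with that p(1) assms(2,3) show thesis by (simp add: has_support_function_def support_function_def)
qed

text \<open>
  Here \<open>K\<close> consists of the centres of the \<open>\<epsilon>\<close>-balls inside the body. The bound \<open>r - \<epsilon>\<close> on its support
  function holds for every \<open>\<epsilon>\<close>. It is attained because the ball that touches the surface at the point
  of contact with the supporting plane of normal \<open>u\<close> reaches up to this plane, so the signed distance of
  its centre is \<open>r u - \<epsilon>\<close>.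
\<close>

lemma inner_parallel_body:
  fixes r :: "real^3 \<Rightarrow> real"
  assumes "closed_convex_surface S" "C2_smooth_surface S" "has_support_function S r"
  obtains \<epsilon> K where "\<epsilon> > 0" "compact K" "convex K" "K \<noteq> {}"
    "\<And>u x. norm u = 1 \<Longrightarrow> x \<in> K \<Longrightarrow> x \<bullet> u \<le> r u - \<epsilon>"
    "\<And>u. norm u = 1 \<Longrightarrow> \<exists>x\<in>K. x \<bullet> u = r u - \<epsilon>"
proof -
  obtain L where L: "bounds_convex_body S L" using assms(1) by (auto simp: closed_convex_surface_def)
  have cL: "compact L" "convex L" using L by (auto simp: bounds_convex_body_def)
  have hL: "x \<bullet> u \<le> r u" if "x \<in> L" "norm u = 1" for x u
    using support_halfspaces[OF L assms(3)] that by auto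
  obtain \<epsilon> where \<epsilon>: "\<epsilon> > 0" "\<And>p. p \<in> S \<Longrightarrow> \<exists>q. dist p q = \<epsilon> \<and> cball q \<epsilon> \<subseteq> L"
    using rolling_ball[OF L assms(2)] by blast
  define K where "K = (\<Inter>b\<in>cball 0 \<epsilon>. (\<lambda>x. - b + x) ` L)"
  have K: "x \<in> K \<longleftrightarrow> cball x \<epsilon> \<subseteq> L" for x
  proof -
    have "x \<in> (\<lambda>x. - b + x) ` L \<longleftrightarrow> x + b \<in> L" for b
      by (auto simp: image_iff algebra_simps intro!: bexI[of _ "x + b"])
    then have "x \<in> K \<longleftrightarrow> (\<forall>b\<in>cball 0 \<epsilon>. x + b \<in> L)"
      unfolding K_def by blast
    also have "\<dots> \<longleftrightarrow> cball x \<epsilon> \<subseteq> L"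
    proof
      assume a: "\<forall>b\<in>cball 0 \<epsilon>. x + b \<in> L"
      show "cball x \<epsilon> \<subseteq> L"
      proof
        fix y assume "y \<in> cball x \<epsilon>"
        then have "y - x \<in> cball 0 \<epsilon>" by (simp add: dist_norm norm_minus_commute)
        from bspec[OF a this] show "y \<in> L" by simp
      qed
    qed (auto simp: dist_norm)
    finally show ?thesis .
  qed
  have cK: "closed K" "convex K"
    unfolding K_def using cL
    by (intro closed_INT convex_INT ballI closed_translation convex_translation compact_imp_closed; simp)+
  have KL: "K \<subseteq> L" using K \<epsilon>(1) by (meson centre_in_cball less_imp_le subset_iff)
  have le: "x \<bullet> u \<le> r u - \<epsilon>" if "norm u = 1" "x \<in> K" for u x
  proof -
    have "x + \<epsilon> *\<^sub>R u \<in> cball x \<epsilon>" using that \<epsilon> by (simp add: dist_norm)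
    then have "x + \<epsilon> *\<^sub>R u \<in> L" using that K by blast
    from hL[OF this that(1)] that(1) show ?thesis by (simp add: inner_add_left norm_eq_1)
  qed
  have att: "\<exists>x\<in>K. x \<bullet> u = r u - \<epsilon>" if u: "norm u = 1" for u
  proof -
    obtain p where p: "p \<in> S" "p \<bullet> u = r u" using support_function_attained[OF L assms(3) u] .
    then obtain q where q: "dist p q = \<epsilon>" "cball q \<epsilon> \<subseteq> L" using \<epsilon>(2) by blast
    have "(p - q) \<bullet> u \<le> \<epsilon>" using norm_cauchy_schwarz[of "p - q" u] q(1) u by (simp add: dist_norm)
    then have "r u - \<epsilon> \<le> q \<bullet> u" using p by (simp add: inner_diff_left)
    moreover have "q \<in> K" using q K by blast
    ultimately show ?thesis using le[OF u] by (meson antisym)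
  qed
  obtain u :: "real^3" where "norm u = 1" using vector_choose_size[of 1] by auto
  then have "K \<noteq> {}" using att by blast
  moreover have "compact K" using compact_Int_closed[OF cL(1) cK(1)] KL by (simp add: inf.absorb2)
  ultimately show thesis using that \<epsilon>(1) cK(2) le att by blast
qed

lemma parallel_body_surface:
  fixes K :: "(real^3) set"
  assumes K: "compact K" "convex K" "K \<noteq> {}" and t: "t > 0"
    and le: "\<And>u x. norm u = 1 \<Longrightarrow> x \<in> K \<Longrightarrow> x \<bullet> u \<le> h u"
    and att: "\<And>u. norm u = 1 \<Longrightarrow> \<exists>x\<in>K. x \<bullet> u = h u"
  shows "bounds_convex_body (frontier (K + cball 0 t)) (K + cball 0 t)"
    and "has_support_function (frontier (K + cball 0 t)) (\<lambda>u. h u + t)"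
proof -
  have c: "compact (K + cball 0 t)"
  proof -
    have "K + cball 0 t = (\<Union>x\<in>K. \<Union>y\<in>cball 0 t. {x + y})" by (auto simp: set_plus_def)
    then show ?thesis using compact_sums'[OF K(1) compact_cball[of 0 t]] by simp
  qed
  have "K + ball 0 t \<subseteq> K + cball 0 t" by (intro set_plus_mono2) auto
  then have "interior (K + cball 0 t) \<noteq> {}"
    using interior_maximal[OF _ open_parallel(1)[OF K]] parallel_nonempty[OF K t] by blast
  then show "bounds_convex_body (frontier (K + cball 0 t)) (K + cball 0 t)"
    unfolding bounds_convex_body_def using c K by (auto intro: convex_set_plus)
  show "has_support_function (frontier (K + cball 0 t)) (\<lambda>u. h u + t)"
  proof (rule has_support_function_frontierI[OF c])
    fix u x :: "real^3" assume u: "norm u = 1"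
    { assume "x \<in> K + cball 0 t"
      then obtain a b where "a \<in> K" "norm b \<le> t" "x = a + b" by (auto simp: set_plus_def)
      then show "x \<bullet> u \<le> h u + t"
        using le[OF u, of a] norm_cauchy_schwarz[of b u] u by (simp add: inner_add_left) }
    obtain q where q: "q \<in> K" "q \<bullet> u = h u" using att[OF u] by blast
    have "q + t *\<^sub>R u \<in> K + cball 0 t" using q u t by (intro set_plus_intro) auto
    moreover have "(q + t *\<^sub>R u) \<bullet> u = h u + t" using q u by (simp add: inner_add_left norm_eq_1)
    ultimately show "\<exists>x\<in>K + cball 0 t. x \<bullet> u = h u + t" by blast
  qed
qed

section \<open>Monotonicity of the isoperimetric ratio\<close>

text \<open>
  With \<open>r\<^sub>0(u) + r\<^sub>0(-u) = w\<^sub>0\<close>, any two points of the parallel body for \<open>C\<close> are at distance at most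
  \<open>w\<^sub>0 + 2 C = 2 R\<close>: evaluate the support function in the direction of their difference and in the
  opposite one. This is the diameter bound for the isodiametric inequality.
\<close>

theorem theorem4:
  fixes S0 :: "(real^3) set" and r0 :: "real^3 \<Rightarrow> real" and w0 C :: real
  assumes "closed_convex_surface S0"
    and "C2_smooth_surface S0"
    and "has_constant_width S0 w0"
    and "has_support_function S0 r0"
    and "\<exists>S. closed_convex_surface S \<and> C2_smooth_surface S \<and>
              has_support_function S (\<lambda>u. r0 u + C)"
  shows "has_constant_width (surface_with_support (\<lambda>u. r0 u + C)) (w0 + 2 * C) \<and>
         (\<exists>D. ((\<lambda>c. isoperimetric_ratio (surface_with_support (\<lambda>u. r0 u + c)))
                 has_real_derivative D) (at C) \<and> D \<ge> 0)"
proof -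
  have w0: "r0 u + r0 (- u) = w0" if "norm u = 1" for u
    using assms(3,4) that by (simp add: has_constant_width_def width_def has_support_function_def)
  have width: "has_constant_width S (w0 + 2 * c)" if "has_support_function S (\<lambda>u. r0 u + c)" for S c
    using that w0 by (simp add: has_constant_width_def width_def has_support_function_def)
  obtain S where S: "closed_convex_surface S" "C2_smooth_surface S" "has_support_function S (\<lambda>u. r0 u + C)"
    using assms(5) by blast
  have first: "has_constant_width (surface_with_support (\<lambda>u. r0 u + C)) (w0 + 2 * C)"
    unfolding surface_with_support_eq[OF S(1,3)] by (rule width[OF S(3)])
  obtain \<epsilon> K where \<epsilon>: "\<epsilon> > 0" and K: "compact K" "convex K" "K \<noteq> {}"
    and le: "\<And>u x. norm u = 1 \<Longrightarrow> x \<in> K \<Longrightarrow> x \<bullet> u \<le> r0 u + C - \<epsilon>"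
    and att: "\<And>u. norm u = 1 \<Longrightarrow> \<exists>x\<in>K. x \<bullet> u = r0 u + C - \<epsilon>"
    using inner_parallel_body[OF S] by blast
  define R where "R = w0 / 2 + C"
  \<comment> \<open>Makes the width \<open>2 (R + (c - C))\<close> positive as long as \<open>\<epsilon> + (c - C) > 0\<close>.\<close>
  have \<epsilon>R: "\<epsilon> \<le> R"
  proof -
    obtain u :: "real^3" where u: "norm u = 1" using vector_choose_size[of 1] by auto
    obtain a where a: "a \<in> K" using K(3) by blast
    have "a \<bullet> u \<le> r0 u + C - \<epsilon>" "a \<bullet> - u \<le> r0 (- u) + C - \<epsilon>"
      using le[OF u a] le[of "- u" a] a u by simp_all
    then show ?thesis using w0[OF u] by (simp add: R_def)
  qed
  \<comment> \<open>Only for these values of \<open>c\<close> is the surface known to exist; they form a neighbourhood of \<open>C\<close>.\<close>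
  have ratio: "isoperimetric_ratio (surface_with_support (\<lambda>u. r0 u + c)) =
      parallel_volume K (\<epsilon> + (c - C)) / (unit_ball_vol DIM(real^3) * (R + (c - C)) ^ DIM(real^3))"
    if c: "c > C - \<epsilon>" for c
  proof -
    define t where "t = \<epsilon> + (c - C)"
    have t: "t > 0" using c by (simp add: t_def)
    let ?S = "frontier (K + cball 0 t)"
    note body = parallel_body_surface[where h = "\<lambda>u. r0 u + C - \<epsilon>", OF K t le att]
    have sup: "has_support_function ?S (\<lambda>u. r0 u + c)"
      using body(2) by (simp add: t_def add_ac)
    have conv: "closed_convex_surface ?S" using body(1) by (auto simp: closed_convex_surface_def)
    have w: "w0 + 2 * c > 0" using \<epsilon>R t \<epsilon> by (simp add: R_def t_def)
    have "bounds_convex_body ?S (K + cball 0 t)" by (rule body(1))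
    then have "enclosed_volume ?S = parallel_volume K t"
      by (simp only: enclosed_volume_eq_body measure_parallel_cball[OF K t])
    then have "isoperimetric_ratio ?S = parallel_volume K t / (pi * (w0 + 2 * c) ^ 3 / 6)"
      by (simp only: isoperimetric_ratio_def constant_width_eq[OF width[OF sup]] enclosed_volume_sphere[OF w])
    also have "pi * (w0 + 2 * c) ^ 3 / 6 = unit_ball_vol DIM(real^3) * (R + (c - C)) ^ DIM(real^3)"
    proof -
      have "w0 + 2 * c = 2 * (R + (c - C))" by (simp add: R_def)
      then show ?thesis by (simp only: power_mult_distrib) (simp add: unit_ball_vol_3)
    qed
    finally show ?thesis unfolding surface_with_support_eq[OF conv sup] t_def .
  qed
  have diam: "dist x y \<le> 2 * R" if xy: "x \<in> K + ball 0 \<epsilon>" "y \<in> K + ball 0 \<epsilon>" for x y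
  proof (cases "x = y")
    case True
    then show ?thesis using \<epsilon> \<epsilon>R by simp
  next
    case False
    define u where "u = (x - y) /\<^sub>R norm (x - y)"
    have u: "norm u = 1" "norm (- u) = 1" using False by (auto simp: u_def)
    have h: "z \<bullet> v \<le> r0 v + C" if zv: "norm v = 1" "z \<in> K + ball 0 \<epsilon>" for z v
    proof -
      obtain a b where "a \<in> K" "norm b < \<epsilon>" "z = a + b" using zv(2) by (auto simp: set_plus_def)
      then show ?thesis
        using le[OF zv(1), of a] norm_cauchy_schwarz[of b v] zv(1) by (simp add: inner_add_left)
    qed
    have "dist x y = (x - y) \<bullet> u"
      using False by (simp add: u_def dist_norm dot_square_norm power2_eq_square)
    also have "\<dots> = x \<bullet> u + y \<bullet> - u" by (simp add: inner_diff_left)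
    also have "\<dots> \<le> 2 * R" using h[OF u(1) xy(1)] h[OF u(2) xy(2)] w0[OF u(1)] by (simp add: R_def)
    finally show ?thesis .
  qed
  define F where "F t = parallel_volume K t / (unit_ball_vol DIM(real^3) * (R + (t - \<epsilon>)) ^ DIM(real^3))" for t
  have "R > 0" using \<epsilon> \<epsilon>R by linarith
  obtain D where D: "D \<ge> 0" "(F has_real_derivative D) (at \<epsilon>)"
    unfolding F_def by (rule parallel_isoperimetric_ratio_derivative[OF K \<epsilon> \<open>R > 0\<close> diam])
  have "(F has_real_derivative D) (at (\<epsilon> + (C - C)))" using D(2) by simp
  moreover have "((\<lambda>c. \<epsilon> + (c - C)) has_real_derivative 1) (at C)"
    by (auto intro!: derivative_eq_intros)
  ultimately have "((\<lambda>c. F (\<epsilon> + (c - C))) has_real_derivative D * 1) (at C)"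
    by (rule DERIV_chain2)
  then have "((\<lambda>c. F (\<epsilon> + (c - C))) has_real_derivative D) (at C)" by simp
  then have "((\<lambda>c. isoperimetric_ratio (surface_with_support (\<lambda>u. r0 u + c))) has_real_derivative D) (at C)"
    by (rule has_field_derivative_transform_within_open[where S = "{C - \<epsilon><..}"])
      (use \<epsilon> ratio in \<open>auto simp: F_def\<close>)
  with first D(1) show ?thesis by blast
qed

end
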